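(* Let $H\in[\tfrac12,1]$. Then the function $g(m)=E\log\left(\int_{-\infty}^{\infty}Z_u e^{mu}\,du\right)$ is twice continuously differentiable on the interval $m\in(-1/8,1/8)$, and \[ \operatorname{Var}(\zeta_H)=\frac{\partial^2 g(m)}{\partial m^2}\Big|_{m=0}. \]
   Context: Let $W^H=\{W^H_s,\ s\in\mathbb{R}\}$ be a two-sided fractional Brownian motion with Hurst parameter $H$: a centered Gaussian process with continuous trajectories, $W^H_0=0$, and $E|W^H_s-W^H_t|^2=|s-t|^{2H}$ for all $s,t\in\mathbb{R}$. Define $Z_t=\exp\{W^H_t-\tfrac12|t|^{2H}\}$, $q_t=Z_t\left(\int_{-\infty}^{\infty}Z_u\,du\right)^{-1}$ for $t\in\mathbb{R}$, and $\zeta_H=\int_{-\infty}^{\infty} t\,q_t\,dt$. *)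

theory Defs
  imports "HOL-Probability.Probability"
begin

definition real_gaussian :: "'a measure \<Rightarrow> ('a \<Rightarrow> real) \<Rightarrow> bool" where
  "real_gaussian M X \<longleftrightarrow>
     (\<exists>\<mu> \<sigma>. \<sigma> > 0 \<and> distributed M lborel X (normal_density \<mu> \<sigma>))
     \<or> (\<exists>c. AE \<omega> in M. X \<omega> = c)"

definition is_two_sided_fBm :: "'a measure \<Rightarrow> real \<Rightarrow> (real \<Rightarrow> 'a \<Rightarrow> real) \<Rightarrow> bool" where
  "is_two_sided_fBm M H W \<longleftrightarrow>
     prob_space M
     \<and> (\<forall>t. W t \<in> borel_measurable M)
     \<and> (\<forall>\<omega>\<in>space M. continuous_on UNIV (\<lambda>t. W t \<omega>))
     \<and> (\<forall>\<omega>\<in>space M. W 0 \<omega> = 0)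
     \<and> (\<forall>(ts :: real list) (cs :: real list). length ts = length cs \<longrightarrow>
          real_gaussian M (\<lambda>\<omega>. \<Sum>i<length ts. cs ! i * W (ts ! i) \<omega>))
     \<and> (\<forall>t. integrable M (W t) \<and> integral\<^sup>L M (W t) = 0)
     \<and> (\<forall>s t. integrable M (\<lambda>\<omega>. (W s \<omega> - W t \<omega>)\<^sup>2)
              \<and> integral\<^sup>L M (\<lambda>\<omega>. (W s \<omega> - W t \<omega>)\<^sup>2) = \<bar>s - t\<bar> powr (2 * H))"

definition fBm_Z :: "real \<Rightarrow> (real \<Rightarrow> 'a \<Rightarrow> real) \<Rightarrow> real \<Rightarrow> 'a \<Rightarrow> real" where
  "fBm_Z H W t \<omega> = exp (W t \<omega> - \<bar>t\<bar> powr (2 * H) / 2)"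

definition fBm_q :: "real \<Rightarrow> (real \<Rightarrow> 'a \<Rightarrow> real) \<Rightarrow> real \<Rightarrow> 'a \<Rightarrow> real" where
  "fBm_q H W t \<omega> = fBm_Z H W t \<omega> / (\<integral>u. fBm_Z H W u \<omega> \<partial>lborel)"

definition fBm_zeta :: "real \<Rightarrow> (real \<Rightarrow> 'a \<Rightarrow> real) \<Rightarrow> 'a \<Rightarrow> real" where
  "fBm_zeta H W \<omega> = (\<integral>t. t * fBm_q H W t \<omega> \<partial>lborel)"

definition fBm_g :: "'a measure \<Rightarrow> real \<Rightarrow> (real \<Rightarrow> 'a \<Rightarrow> real) \<Rightarrow> real \<Rightarrow> real" where
  "fBm_g M H W m = (\<integral>\<omega>. ln (\<integral>u. fBm_Z H W u \<omega> * exp (m * u) \<partial>lborel) \<partial>M)"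

end

theory Submission
  imports Defs
begin

text \<open>
  Write \<open>L u = W u - \<bar>u\<bar> powr (2 * H) / 2\<close>, so that \<open>Z = exp L\<close>, and let \<open>q m\<close> be the probability density on the line
  proportional to \<open>Z u * exp (m * u)\<close>. Path by path, the first two derivatives of \<open>ln (\<integral>u. Z u * exp (m * u))\<close>
  in \<open>m\<close> are the mean and the variance of \<open>q m\<close>.

  To differentiate under the expectation one needs a dominating function. Estimating the normalising integral from below
  by its parts near \<open>0\<close> and near \<open>u\<close>, and then by the geometric mean of the two, gives for \<open>\<bar>m\<bar> \<le> 1/8\<close> a pointwise
  bound \<open>q m u \<le> G u\<close> with \<open>G u = exp (1/8 + \<bar>u\<bar> / 16) * (\<integral>v. exp (L u - L v / 2 - L (u + v) / 2))\<close>, \<open>v\<close> ranging over a unit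
  interval at \<open>0\<close>. The Gaussian moment of the integrand is at most \<open>exp (pw v - pw u / 8)\<close> with \<open>pw t = \<bar>t\<bar> powr (2 * H)\<close>, because
  \<open>pw (u - v) + pw (u + v) \<le> 2 * pw u + 2 * pw v\<close>. Hence \<open>\<integral>u. (1 + u\<^sup>2) * G u\<close> is integrable, and it dominates everything.

  For the variance identity, under the probability measure with density \<open>Z t\<close> the process \<open>L\<close> has the law of
  \<open>u \<mapsto> L (u - t) - L (- t)\<close> (Cameron--Martin and stationary increments). Thus \<open>q 0\<close> is a posterior density for a
  shift, \<open>\<zeta>\<close> is the posterior mean, and its mean square error equals the expected variance of \<open>q 0\<close>.
\<close>

section \<open>Characteristic functions and joint laws\<close>

text \<open>Neither half of the lower bound suffices alone. Using only the part near
  \<open>0\<close>, or only the part near \<open>u\<close>, leaves at \<open>v = 0\<close> the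
  ratios \<open>Z u / Z 0\<close> or \<open>Z u / Z u\<close>, both of expectation 1, so nothing
  decays in \<open>u\<close>. The geometric mean leaves \<open>exp (L u / 2)\<close> there, of
  expectation \<open>exp (- pw u / 8)\<close>. Since \<open>1/2 \<le> H\<close>, this is exponential
  decay of rate at least 1/8, while the tilt costs only \<open>exp (|u| / 16)\<close>, because half
  of \<open>m * u\<close> cancels in the quotient. The condition \<open>H \<le> 1\<close> is what
  the inequality for \<open>pw (u - v) + pw (u + v)\<close> rests on. The change of measure must be
  proved for whole paths, with an exponential weight. Everything is reduced to uniqueness of
  characteristic functions on the line: nonnegative trigonometric weights handle several
  coordinates, and also take the place of an analytic continuation to complex frequencies.\<close>

lemma distr_density_eqI_char:
  fixes X :: "'a \<Rightarrow> real" and Y :: "'b \<Rightarrow> real"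
  assumes X[measurable]: "X \<in> borel_measurable M" and Y[measurable]: "Y \<in> borel_measurable N"
    and f: "integrable M f" "\<And>x. 0 \<le> f x" and g: "integrable N g" "\<And>y. 0 \<le> g y"
    and eq: "\<And>a. (\<integral>x. of_real (f x) * iexp (a * X x) \<partial>M) = (\<integral>y. of_real (g y) * iexp (a * Y y) \<partial>N)"
  shows "distr (density M (\<lambda>x. ennreal (f x))) borel X = distr (density N (\<lambda>y. ennreal (g y))) borel Y"
proof -
  have fm[measurable]: "f \<in> borel_measurable M" and gm[measurable]: "g \<in> borel_measurable N"
    using f g by auto
  define c where "c = integral\<^sup>L M f"
  \<comment> \<open>The frequency \<open>a = 0\<close> gives equal total masses. Mass 0 is treated
    apart, because the measures are normalised before uniqueness on the line is applied.\<close>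
  have c2: "c = integral\<^sup>L N g"
    using eq[of 0] by (simp add: c_def)
  have c0: "c \<ge> 0" unfolding c_def using f by (simp add: integral_nonneg_AE)
  show ?thesis
  proof (cases "c = 0")
    case True
    then have "AE x in M. f x = 0" "AE y in N. g y = 0"
      using f g c2 integral_nonneg_eq_0_iff_AE[of M f] integral_nonneg_eq_0_iff_AE[of N g] by (auto simp: c_def)
    note z = this
    have "(\<integral>\<^sup>+x. ennreal (f x) * indicator (X -` A \<inter> space M) x \<partial>M)
        = (\<integral>\<^sup>+y. ennreal (g y) * indicator (Y -` A \<inter> space N) y \<partial>N)"
      if "A \<in> sets borel" for A
    proof -
      have "(\<integral>\<^sup>+x. ennreal (f x) * indicator (X -` A \<inter> space M) x \<partial>M) = (\<integral>\<^sup>+x. 0 \<partial>M)"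
        by (rule nn_integral_cong_AE) (use z(1) in auto)
      moreover have "(\<integral>\<^sup>+x. ennreal (g x) * indicator (Y -` A \<inter> space N) x \<partial>N) = (\<integral>\<^sup>+x. 0 \<partial>N)"
        by (rule nn_integral_cong_AE) (use z(2) in auto)
      ultimately show ?thesis by simp
    qed
    then show ?thesis
      by (intro measure_eqI) (simp_all add: emeasure_distr emeasure_density)
  next
    case False
    with c0 have c: "c > 0" by simp
    define P where "P = distr (density M (\<lambda>x. ennreal (f x / c))) borel X"
    define Q where "Q = distr (density N (\<lambda>x. ennreal (g x / c))) borel Y"
    have nf: "(\<integral>\<^sup>+x. ennreal (f x / c) \<partial>M) = 1"
      using f c by (subst nn_integral_eq_integral) (auto simp: c_def)
    have ng: "(\<integral>\<^sup>+x. ennreal (g x / c) \<partial>N) = 1"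
      using g c by (subst nn_integral_eq_integral) (auto simp: c2)
    have pP: "prob_space (density M (\<lambda>x. ennreal (f x / c)))"
      by (rule prob_spaceI) (simp add: emeasure_density nf cong: nn_integral_cong)
    have pQ: "prob_space (density N (\<lambda>x. ennreal (g x / c)))"
      by (rule prob_spaceI) (simp add: emeasure_density ng cong: nn_integral_cong)
    have rP: "real_distribution P" unfolding P_def
      using prob_space.real_distribution_distr[OF pP] by simp
    have rQ: "real_distribution Q" unfolding Q_def
      using prob_space.real_distribution_distr[OF pQ] by simp
    have "char P = char Q"
    proof
      fix a
      have "char P a = (\<integral>x. (f x / c) *\<^sub>R iexp (a * X x) \<partial>M)"
        unfolding char_def P_def using c f
        by (subst integral_distr; (subst integral_density)?) auto
      also have "\<dots> = (1 / c) *\<^sub>R (\<integral>x. of_real (f x) * iexp (a * X x) \<partial>M)"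
        by (subst integral_scaleR_right[symmetric]) (simp add: scaleR_conv_of_real)
      also have "\<dots> = (1 / c) *\<^sub>R (\<integral>x. of_real (g x) * iexp (a * Y x) \<partial>N)"
        by (simp only: eq)
      also have "\<dots> = (\<integral>x. (g x / c) *\<^sub>R iexp (a * Y x) \<partial>N)"
        by (subst integral_scaleR_right[symmetric]) (simp add: scaleR_conv_of_real)
      also have "\<dots> = char Q a"
        unfolding char_def Q_def using c g
        by (subst integral_distr; (subst integral_density)?) auto
      finally show "char P a = char Q a" .
    qed
    then have PQ: "P = Q" using Levy_uniqueness[OF rP rQ] by simp
    have sM: "density M (\<lambda>x. ennreal (f x)) = scale_measure (ennreal c) (density M (\<lambda>x. ennreal (f x / c)))"
      using c f by (intro measure_eqI)
       (auto simp: emeasure_density nn_integral_cmult[symmetric] ennreal_mult[symmetric] mult.assoc[symmetric]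
             intro!: nn_integral_cong)
    have sN: "density N (\<lambda>x. ennreal (g x)) = scale_measure (ennreal c) (density N (\<lambda>x. ennreal (g x / c)))"
      using c g by (intro measure_eqI)
       (auto simp: emeasure_density nn_integral_cmult[symmetric] ennreal_mult[symmetric] mult.assoc[symmetric]
             intro!: nn_integral_cong)
    show ?thesis
    proof (rule measure_eqI)
      fix A assume A: "A \<in> sets (distr (density M (\<lambda>x. ennreal (f x))) borel X)"
      have "emeasure P A = emeasure Q A" by (simp add: PQ)
      with A show "emeasure (distr (density M (\<lambda>x. ennreal (f x))) borel X) A
                 = emeasure (distr (density N (\<lambda>x. ennreal (g x))) borel Y) A"
        by (simp add: sM sN emeasure_distr P_def Q_def space_scale_measure)
    qed simp
  qed
qed

text \<open>Both sides are integrals of \<open>h\<close> against the same law on the line; if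
  \<open>h\<close> is not integrable, both are 0. Later \<open>h\<close> is an indicator in one use
  and an exponential times a character in another.\<close>

lemma integral_vimage_eqI_char:
  fixes X :: "'a \<Rightarrow> real" and Y :: "'b \<Rightarrow> real" and h :: "real \<Rightarrow> complex"
  assumes X[measurable]: "X \<in> borel_measurable M" and Y[measurable]: "Y \<in> borel_measurable N"
    and f: "integrable M f" "\<And>x. 0 \<le> f x" and g: "integrable N g" "\<And>y. 0 \<le> g y"
    and eq: "\<And>a. (\<integral>x. of_real (f x) * iexp (a * X x) \<partial>M) = (\<integral>y. of_real (g y) * iexp (a * Y y) \<partial>N)"
    and h[measurable]: "h \<in> borel_measurable borel"
  shows "(\<integral>x. of_real (f x) * h (X x) \<partial>M) = (\<integral>y. of_real (g y) * h (Y y) \<partial>N)"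
proof -
  have fm[measurable]: "f \<in> borel_measurable M" and gm[measurable]: "g \<in> borel_measurable N"
    using f g by auto
  have "(\<integral>x. of_real (f x) * h (X x) \<partial>M) = integral\<^sup>L (distr (density M (\<lambda>x. ennreal (f x))) borel X) h"
    using f by (subst integral_distr; (subst integral_density)?) (auto simp: scaleR_conv_of_real)
  also have "\<dots> = integral\<^sup>L (distr (density N (\<lambda>y. ennreal (g y))) borel Y) h"
    by (simp add: distr_density_eqI_char[OF X Y f g eq])
  also have "\<dots> = (\<integral>y. of_real (g y) * h (Y y) \<partial>N)"
    using g by (subst integral_distr; (subst integral_density)?) (auto simp: scaleR_conv_of_real)
  finally show ?thesis .
qed

lemma integral_lincomb3:
  fixes f g h :: "'a \<Rightarrow> complex"
  assumes "integrable M f" "integrable M g" "integrable M h"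
  shows "(\<integral>x. f x + c * g x + d * h x \<partial>M) = integral\<^sup>L M f + c * integral\<^sup>L M g + d * integral\<^sup>L M h"
  using assms by simp

text \<open>A nonnegative weight times a character is a combination of three characters, here and in
  the sine version. The redundant \<open>0 * y\<close>, \<open>1 * y\<close>,
  \<open>(-1) * y\<close> make them instances of one pattern \<open>x + e * y\<close>, so that a
  single equation quantified over \<open>e\<close> rewrites all three.\<close>

lemma one_plus_cos_times_iexp:
  fixes w x y :: real
  shows "of_real (w * (1 + cos y)) * iexp x = of_real w * iexp (x + 0 * y)
         + (1/2) * (of_real w * iexp (x + 1 * y)) + (1/2) * (of_real w * iexp (x + (-1) * y))"
proof -
  have trig: "iexp x * cos y = (iexp (x + 1 * y) + iexp (x + (-1) * y)) / 2"
    by (simp add: cos_of_real[symmetric] cos_exp_eq algebra_simps flip: exp_add exp_minus)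
  have "of_real (w * (1 + cos y)) * iexp x = of_real w * iexp (x + 0 * y) + of_real w * (iexp x * cos y)"
    by (simp add: algebra_simps)
  then show ?thesis unfolding trig by (simp only: ring_distribs add_divide_distrib) simp
qed

lemma one_plus_sin_times_iexp:
  fixes w x y :: real
  shows "of_real (w * (1 + sin y)) * iexp x = of_real w * iexp (x + 0 * y)
         + (1/(2*\<i>)) * (of_real w * iexp (x + 1 * y)) + (-1/(2*\<i>)) * (of_real w * iexp (x + (-1) * y))"
proof -
  have trig: "iexp x * sin y = (iexp (x + 1 * y) - iexp (x + (-1) * y)) / (2 * \<i>)"
    by (simp add: sin_of_real[symmetric] sin_exp_eq algebra_simps divide_simps flip: exp_add exp_minus)
  have "of_real (w * (1 + sin y)) * iexp x = of_real w * iexp (x + 0 * y) + of_real w * (iexp x * sin y)"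
    by (simp add: algebra_simps)
  then show ?thesis unfolding trig
    by (simp only: ring_distribs diff_divide_distrib) (simp add: mult_ac)
qed

text \<open>The way back from nonnegative weights: a character is recovered from the two
  trigonometric weights and the constant weight.\<close>

lemma iexp_eq_one_plus_trig: "iexp s = of_real (1 + cos s) + \<i> * of_real (1 + sin s) - (1 + \<i>)"
  by (simp add: cis_conv_exp[symmetric] complex_eq_iff)

text \<open>One-dimensional uniqueness is applied to one coordinate at a time, with the characters of the remaining coordinates
  put into the nonnegative weights \<open>1 + cos S\<close> and \<open>1 + sin S\<close>; the weights \<open>f\<close> and \<open>g\<close> absorb the coordinates already treated.\<close>

lemma joint_law_eqI_char:
  fixes X :: "'i \<Rightarrow> 'a \<Rightarrow> real" and Y :: "'i \<Rightarrow> 'b \<Rightarrow> real"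
  assumes "finite J"
    and "\<And>j. j \<in> J \<Longrightarrow> X j \<in> borel_measurable M" and "\<And>j. j \<in> J \<Longrightarrow> Y j \<in> borel_measurable N"
    and "integrable M f" "\<And>x. 0 \<le> f x" and "integrable N g" "\<And>y. 0 \<le> g y"
    and "\<And>\<theta>. (\<integral>x. of_real (f x) * iexp (\<Sum>j\<in>J. \<theta> j * X j x) \<partial>M)
             = (\<integral>y. of_real (g y) * iexp (\<Sum>j\<in>J. \<theta> j * Y j y) \<partial>N)"
    and "\<And>j. j \<in> J \<Longrightarrow> A j \<in> sets borel"
  shows "(\<integral>x. f x * (\<Prod>j\<in>J. indicator (A j) (X j x)) \<partial>M) = (\<integral>y. g y * (\<Prod>j\<in>J. indicator (A j) (Y j y)) \<partial>N)"
  using assms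
proof (induction J arbitrary: f g rule: finite_induct)
  case empty
  from empty(7)[of "\<lambda>_. 0"] have "(\<integral>x. f x \<partial>M) = (\<integral>x. g x \<partial>N)"
    by (simp add: integral_of_real)
  then show ?case by simp
next
  case (insert j J)
  note [measurable] = insert.prems(1,2) [of j, simplified]
  have [measurable]: "X k \<in> borel_measurable M" "Y k \<in> borel_measurable N" if "k \<in> J" for k
    using insert.prems(1,2) that by auto
  have [measurable]: "f \<in> borel_measurable M" "g \<in> borel_measurable N" using insert.prems by auto
  have Aj[measurable]: "A j \<in> sets borel" using insert.prems by auto
  let ?f = "\<lambda>x. f x * indicator (A j) (X j x)" and ?g = "\<lambda>x. g x * indicator (A j) (Y j x)"
  have If: "integrable M (\<lambda>x. f x * r x)" if [measurable]: "r \<in> borel_measurable M" and "\<And>x. \<bar>r x\<bar> \<le> B" for r B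
    by (rule Bochner_Integration.integrable_bound[OF integrable_mult_left[OF insert.prems(3), of B]])
       (use that insert.prems(4,6) in \<open>auto simp: abs_mult intro!: AE_I2 mult_left_mono order_trans[OF _ abs_ge_self]\<close>)
  have Ig: "integrable N (\<lambda>x. g x * r x)" if [measurable]: "r \<in> borel_measurable N" and "\<And>x. \<bar>r x\<bar> \<le> B" for r B
    by (rule Bochner_Integration.integrable_bound[OF integrable_mult_left[OF insert.prems(5), of B]])
       (use that insert.prems(4,6) in \<open>auto simp: abs_mult intro!: AE_I2 mult_left_mono order_trans[OF _ abs_ge_self]\<close>)
  have Cf: "integrable M (\<lambda>x. complex_of_real (f x) * r x)" if [measurable]: "r \<in> borel_measurable M" and "\<And>x. cmod (r x) \<le> 1" for r
    by (rule Bochner_Integration.integrable_bound[OF insert.prems(3)])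
       (use that in \<open>auto simp: norm_mult intro!: AE_I2 mult_left_le\<close>)
  have Cg: "integrable N (\<lambda>x. complex_of_real (g x) * r x)" if [measurable]: "r \<in> borel_measurable N" and "\<And>x. cmod (r x) \<le> 1" for r
    by (rule Bochner_Integration.integrable_bound[OF insert.prems(5)])
       (use that in \<open>auto simp: norm_mult intro!: AE_I2 mult_left_le\<close>)
  have "(\<integral>x. of_real (?f x) * iexp (\<Sum>j\<in>J. \<theta> j * X j x) \<partial>M)
      = (\<integral>y. of_real (?g y) * iexp (\<Sum>j\<in>J. \<theta> j * Y j y) \<partial>N)" for \<theta>
  proof -
    define S where "S x = (\<Sum>j\<in>J. \<theta> j * X j x)" for x
    define T where "T x = (\<Sum>j\<in>J. \<theta> j * Y j x)" for x
    have [measurable]: "S \<in> borel_measurable M" "T \<in> borel_measurable N"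
      unfolding S_def[abs_def] T_def[abs_def] by measurable
    \<comment> \<open>The joint hypothesis at frequency \<open>a\<close> in the new coordinate and
      \<open>e\<close> times \<open>\<theta>\<close> in the others; \<open>e\<close> takes the
      values 0, 1 and -1.\<close>
    have key: "(\<integral>x. of_real (f x) * iexp (a * X j x + e * S x) \<partial>M)
             = (\<integral>x. of_real (g x) * iexp (a * Y j x + e * T x) \<partial>N)" for a e
    proof -
      have 1: "(\<Sum>k\<in>insert j J. (if k = j then a else e * \<theta> k) * V k x) = a * V j x + e * (\<Sum>k\<in>J. \<theta> k * V k x)" 
        for x and V :: "'i \<Rightarrow> 'c \<Rightarrow> real"
      proof -
        have "(\<Sum>k\<in>J. (if k = j then a else e * \<theta> k) * V k x) = (\<Sum>k\<in>J. e * \<theta> k * V k x)"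
          using insert.hyps by (intro sum.cong) auto
        then show ?thesis using insert.hyps by (simp add: sum_distrib_left mult.assoc)
      qed
      show ?thesis using insert.prems(7)[of "\<lambda>k. if k = j then a else e * \<theta> k"]
        unfolding 1 by (simp add: S_def T_def)
    qed
    have cb: "\<bar>1 + cos s\<bar> \<le> 2" for s :: real
      using cos_le_one[of s] cos_ge_minus_one[of s] by linarith
    have sb: "\<bar>1 + sin s\<bar> \<le> 2" for s :: real
      using sin_le_one[of s] sin_ge_minus_one[of s] by linarith
    have Cf1: "integrable M (\<lambda>x. complex_of_real (f x) * iexp (a * X j x + e * S x))" for a e
      by (rule Cf) auto
    have Cg1: "integrable N (\<lambda>x. complex_of_real (g x) * iexp (a * Y j x + e * T x))" for a e
      by (rule Cg) auto
    have E0: "(\<integral>x. of_real (f x) * of_real (indicator (A j) (X j x)) \<partial>M)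
        = (\<integral>x. of_real (g x) * complex_of_real (indicator (A j) (Y j x)) \<partial>N)"
      by (rule integral_vimage_eqI_char[where h="\<lambda>x. of_real (indicator (A j) x)"])
         (use key[of _ 0] insert.prems in \<open>auto\<close>)
    have Ec: "(\<integral>x. of_real (f x * (1 + cos (S x))) * of_real (indicator (A j) (X j x)) \<partial>M)
        = (\<integral>x. of_real (g x * (1 + cos (T x))) * complex_of_real (indicator (A j) (Y j x)) \<partial>N)"
    proof (rule integral_vimage_eqI_char[where h="\<lambda>x. of_real (indicator (A j) x)"])
      show "integrable M (\<lambda>x. f x * (1 + cos (S x)))"
        by (rule If[OF _ cb]) auto
      show "integrable N (\<lambda>x. g x * (1 + cos (T x)))"
        by (rule Ig[OF _ cb]) auto
      show "0 \<le> f x * (1 + cos (S x))" for x 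
        using insert.prems(4)[of x] cos_ge_minus_one[of "S x"] by (intro mult_nonneg_nonneg) linarith+
      show "0 \<le> g x * (1 + cos (T x))" for x 
        using insert.prems(6)[of x] cos_ge_minus_one[of "T x"] by (intro mult_nonneg_nonneg) linarith+
      fix a
      have "(\<integral>x. of_real (f x * (1 + cos (S x))) * iexp (a * X j x) \<partial>M) = 
         (\<integral>x. of_real (f x) * iexp (a * X j x + 0 * S x) + (1/2) * (of_real (f x) * iexp (a * X j x + 1 * S x))
               + (1/2) * (of_real (f x) * iexp (a * X j x + (-1) * S x)) \<partial>M)"
        by (rule Bochner_Integration.integral_cong[OF refl]) (rule one_plus_cos_times_iexp)
      also have "\<dots> = (\<integral>x. of_real (g x) * iexp (a * Y j x + 0 * T x) + (1/2) * (of_real (g x) * iexp (a * Y j x + 1 * T x))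
               + (1/2) * (of_real (g x) * iexp (a * Y j x + (-1) * T x)) \<partial>N)"
        by (simp only: integral_lincomb3[OF Cf1 Cf1 Cf1] integral_lincomb3[OF Cg1 Cg1 Cg1] key)
      also have "\<dots> = (\<integral>x. of_real (g x * (1 + cos (T x))) * iexp (a * Y j x) \<partial>N)"
        by (rule Bochner_Integration.integral_cong[OF refl]) (rule one_plus_cos_times_iexp[symmetric])
      finally show "(\<integral>x. of_real (f x * (1 + cos (S x))) * iexp (a * X j x) \<partial>M) =
          (\<integral>x. of_real (g x * (1 + cos (T x))) * iexp (a * Y j x) \<partial>N)" .
    qed auto
    have Es: "(\<integral>x. of_real (f x * (1 + sin (S x))) * of_real (indicator (A j) (X j x)) \<partial>M)
        = (\<integral>x. of_real (g x * (1 + sin (T x))) * complex_of_real (indicator (A j) (Y j x)) \<partial>N)"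
    proof (rule integral_vimage_eqI_char[where h="\<lambda>x. of_real (indicator (A j) x)"])
      show "integrable M (\<lambda>x. f x * (1 + sin (S x)))"
        by (rule If[OF _ sb]) auto
      show "integrable N (\<lambda>x. g x * (1 + sin (T x)))"
        by (rule Ig[OF _ sb]) auto
      show "0 \<le> f x * (1 + sin (S x))" for x 
        using insert.prems(4)[of x] sin_ge_minus_one[of "S x"] by (intro mult_nonneg_nonneg) linarith+
      show "0 \<le> g x * (1 + sin (T x))" for x 
        using insert.prems(6)[of x] sin_ge_minus_one[of "T x"] by (intro mult_nonneg_nonneg) linarith+
      fix a
      have "(\<integral>x. of_real (f x * (1 + sin (S x))) * iexp (a * X j x) \<partial>M) = 
         (\<integral>x. of_real (f x) * iexp (a * X j x + 0 * S x) + (1/(2*\<i>)) * (of_real (f x) * iexp (a * X j x + 1 * S x))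
               + (-1/(2*\<i>)) * (of_real (f x) * iexp (a * X j x + (-1) * S x)) \<partial>M)"
        by (rule Bochner_Integration.integral_cong[OF refl]) (rule one_plus_sin_times_iexp)
      also have "\<dots> = (\<integral>x. of_real (g x) * iexp (a * Y j x + 0 * T x) + (1/(2*\<i>)) * (of_real (g x) * iexp (a * Y j x + 1 * T x))
               + (-1/(2*\<i>)) * (of_real (g x) * iexp (a * Y j x + (-1) * T x)) \<partial>N)"
        by (simp only: integral_lincomb3[OF Cf1 Cf1 Cf1] integral_lincomb3[OF Cg1 Cg1 Cg1] key)
      also have "\<dots> = (\<integral>x. of_real (g x * (1 + sin (T x))) * iexp (a * Y j x) \<partial>N)"
        by (rule Bochner_Integration.integral_cong[OF refl]) (rule one_plus_sin_times_iexp[symmetric])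
      finally show "(\<integral>x. of_real (f x * (1 + sin (S x))) * iexp (a * X j x) \<partial>M) =
          (\<integral>x. of_real (g x * (1 + sin (T x))) * iexp (a * Y j x) \<partial>N)" .
    qed auto
    have bd: "\<bar>(1 + cos s) * indicator (A j) u\<bar> \<le> 2" "\<bar>(1 + sin s) * indicator (A j) u\<bar> \<le> 2" for s u :: real
      using cb[of s] sb[of s] by (auto simp: indicator_def)
    have i1: "integrable M (\<lambda>x. complex_of_real (f x * (1 + cos (S x))) * of_real (indicator (A j) (X j x)))"
      using If[OF _ bd(1), of S "X j"] by (simp add: mult.assoc flip: of_real_mult)
    have i2: "integrable M (\<lambda>x. complex_of_real (f x * (1 + sin (S x))) * of_real (indicator (A j) (X j x)))"
      using If[OF _ bd(2), of S "X j"] by (simp add: mult.assoc flip: of_real_mult)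
    have i3: "integrable M (\<lambda>x. complex_of_real (f x) * of_real (indicator (A j) (X j x)))"
      by (rule Cf) (auto simp: indicator_def)
    have j1: "integrable N (\<lambda>x. complex_of_real (g x * (1 + cos (T x))) * of_real (indicator (A j) (Y j x)))"
      using Ig[OF _ bd(1), of T "Y j"] by (simp add: mult.assoc flip: of_real_mult)
    have j2: "integrable N (\<lambda>x. complex_of_real (g x * (1 + sin (T x))) * of_real (indicator (A j) (Y j x)))"
      using Ig[OF _ bd(2), of T "Y j"] by (simp add: mult.assoc flip: of_real_mult)
    have j3: "integrable N (\<lambda>x. complex_of_real (g x) * of_real (indicator (A j) (Y j x)))"
      by (rule Cg) (auto simp: indicator_def)
    have "(\<integral>x. of_real (?f x) * iexp (S x) \<partial>M)
      = (\<integral>x. of_real (f x * (1 + cos (S x))) * of_real (indicator (A j) (X j x))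
           + \<i> * (of_real (f x * (1 + sin (S x))) * of_real (indicator (A j) (X j x)))
           + (- (1 + \<i>)) * (of_real (f x) * of_real (indicator (A j) (X j x))) \<partial>M)"
      unfolding iexp_eq_one_plus_trig by (rule Bochner_Integration.integral_cong[OF refl]) (simp add: algebra_simps)
    also have "\<dots> = (\<integral>x. of_real (g x * (1 + cos (T x))) * of_real (indicator (A j) (Y j x))
           + \<i> * (of_real (g x * (1 + sin (T x))) * of_real (indicator (A j) (Y j x)))
           + (- (1 + \<i>)) * (of_real (g x) * of_real (indicator (A j) (Y j x))) \<partial>N)"
      by (simp only: integral_lincomb3[OF i1 i2 i3] integral_lincomb3[OF j1 j2 j3] E0 Ec Es)
    also have "\<dots> = (\<integral>x. of_real (?g x) * iexp (T x) \<partial>N)"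
      unfolding iexp_eq_one_plus_trig by (rule Bochner_Integration.integral_cong[OF refl]) (simp add: algebra_simps)
    finally show ?thesis unfolding S_def T_def .
  qed
  then have "(\<integral>x. ?f x * (\<Prod>j\<in>J. indicator (A j) (X j x)) \<partial>M) = (\<integral>y. ?g y * (\<Prod>j\<in>J. indicator (A j) (Y j y)) \<partial>N)"
    by (intro insert.IH) (use insert.prems in \<open>auto intro!: If[of _ 1] Ig[of _ 1] simp: indicator_def\<close>)
  then show ?case using insert.hyps by (simp add: mult.assoc)
qed

section \<open>Gaussian random variables\<close>

text \<open>\<open>real_gaussian\<close> admits almost surely constant variables. A centred one is
  almost surely 0, so the variance decides between the degenerate case and the case with a
  density.\<close>

lemma (in prob_space) centered_gaussian_cases:
  assumes "real_gaussian M X" and [measurable]: "X \<in> borel_measurable M"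
    and "expectation X = 0" and "expectation (\<lambda>\<omega>. (X \<omega>)\<^sup>2) = v"
  obtains "v = 0" "AE \<omega> in M. X \<omega> = 0" | "v > 0" "distributed M lborel X (normal_density 0 (sqrt v))"
proof -
  from assms(1) consider \<mu> \<sigma> where "\<sigma> > 0" "distributed M lborel X (normal_density \<mu> \<sigma>)"
    | c where "AE \<omega> in M. X \<omega> = c" unfolding real_gaussian_def by auto
  then show ?thesis
  proof cases
    case 1
    have mu: "\<mu> = 0" using normal_distributed_expectation[OF 1] assms(3) by simp
    have "v = \<sigma>\<^sup>2" using normal_distributed_variance[OF 1] assms(3,4) by simp
    then show ?thesis using 1 mu that(2) by simp
  next
    case 2
    have "expectation X = expectation (\<lambda>_. c)" by (rule integral_cong_AE) (use 2 in auto)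
    then have c: "c = 0" using assms(3) by (simp add: prob_space)
    have "v = expectation (\<lambda>_. 0)" unfolding assms(4)[symmetric] by (rule integral_cong_AE) (use 2 c in auto)
    then show ?thesis using 2 c that(1) by simp
  qed
qed

lemma (in prob_space) normal_distributed_char:
  assumes "\<sigma> > 0" "distributed M lborel X (normal_density \<mu> \<sigma>)"
  shows "(\<integral>\<omega>. iexp (a * X \<omega>) \<partial>M) = iexp (a * \<mu>) * exp (- of_real (a\<^sup>2 * \<sigma>\<^sup>2 / 2))"
proof -
  have [measurable]: "X \<in> borel_measurable M" using assms(2) by (simp add: distributed_def)
  define Y where "Y = (\<lambda>\<omega>. (X \<omega> - \<mu>) / \<sigma>)"
  have [measurable]: "Y \<in> borel_measurable M" unfolding Y_def by measurable
  have "distributed M lborel Y std_normal_density"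
    using normal_standard_normal_convert[OF assms(1), of X \<mu>] assms(2) by (simp add: Y_def)
  then have d: "distr M lborel Y = density lborel std_normal_density"
    by (simp add: distributed_def)
  have X: "X \<omega> = \<mu> + \<sigma> * Y \<omega>" for \<omega> using assms(1) by (simp add: Y_def)
  have "(\<integral>\<omega>. iexp (a * X \<omega>) \<partial>M) = (\<integral>\<omega>. iexp (a * \<mu>) * iexp (a * \<sigma> * Y \<omega>) \<partial>M)"
    by (rule Bochner_Integration.integral_cong) (auto simp: X algebra_simps simp flip: exp_add)
  also have "\<dots> = iexp (a * \<mu>) * (\<integral>\<omega>. iexp (a * \<sigma> * Y \<omega>) \<partial>M)" by simp
  also have "(\<integral>\<omega>. iexp (a * \<sigma> * Y \<omega>) \<partial>M) = (\<integral>y. iexp (a * \<sigma> * y) \<partial>distr M lborel Y)"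
    by (subst integral_distr) auto
  also have "\<dots> = char std_normal_distribution (a * \<sigma>)" unfolding d char_def ..
  also have "\<dots> = exp (- of_real (a\<^sup>2 * \<sigma>\<^sup>2 / 2))"
    by (simp add: char_std_normal_distribution power_mult_distrib flip: exp_of_real)
  finally show ?thesis .
qed

text \<open>Completing the square: the factor \<open>exp x\<close> moves the mean by the variance
  and contributes the mass \<open>exp (\<sigma>\<^sup>2 / 2)\<close>.\<close>

lemma normal_density_times_exp:
  assumes "\<sigma> > 0"
  shows "normal_density 0 \<sigma> x * exp x = exp (\<sigma>\<^sup>2 / 2) * normal_density (\<sigma>\<^sup>2) \<sigma> x"
proof -
  have "- (x\<^sup>2) / (2 * \<sigma>\<^sup>2) + x = \<sigma>\<^sup>2 / 2 + - ((x - \<sigma>\<^sup>2)\<^sup>2) / (2 * \<sigma>\<^sup>2)"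
    using assms by (simp add: field_simps power2_eq_square)
  then have "exp (- (x\<^sup>2) / (2 * \<sigma>\<^sup>2)) * exp x = exp (\<sigma>\<^sup>2 / 2) * exp (- ((x - \<sigma>\<^sup>2)\<^sup>2) / (2 * \<sigma>\<^sup>2))"
    by (simp flip: exp_add)
  then show ?thesis by (simp add: normal_density_def)
qed

text \<open>Cameron--Martin on the line: under the weight \<open>exp X\<close> the variable is
  normal with mean \<open>v\<close> and unchanged variance, and the total mass is
  \<open>exp (v/2)\<close>.\<close>

lemma (in prob_space) gaussian_tilted_char:
  assumes g: "real_gaussian M X" and X[measurable]: "X \<in> borel_measurable M"
    and m: "expectation X = 0" "expectation (\<lambda>\<omega>. (X \<omega>)\<^sup>2) = v"
  shows "integrable M (\<lambda>\<omega>. exp (X \<omega>))"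
    and "(\<integral>\<omega>. of_real (exp (X \<omega>)) * iexp (a * X \<omega>) \<partial>M) = of_real (exp (v/2)) * iexp (a * v) * exp (- of_real (a\<^sup>2 * v / 2))"
proof -
  have "integrable M (\<lambda>\<omega>. exp (X \<omega>)) \<and> (\<integral>\<omega>. of_real (exp (X \<omega>)) * iexp (a * X \<omega>) \<partial>M)
      = of_real (exp (v/2)) * iexp (a * v) * exp (- of_real (a\<^sup>2 * v / 2))"
    using g X m
  proof (cases rule: centered_gaussian_cases)
    case 1
    have "integrable M (\<lambda>\<omega>. exp (X \<omega>)) \<longleftrightarrow> integrable M (\<lambda>\<omega>. 1::real)"
      by (rule integrable_cong_AE) (use 1 in auto)
    moreover have "(\<integral>\<omega>. of_real (exp (X \<omega>)) * iexp (a * X \<omega>) \<partial>M) = (\<integral>\<omega>. (1::complex) \<partial>M)"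
      by (rule integral_cong_AE) (use 1 in auto)
    ultimately show ?thesis using 1 by (simp add: prob_space)
  next
    case 2
    define \<sigma> where "\<sigma> = sqrt v"
    have s: "\<sigma> > 0" "\<sigma>\<^sup>2 = v" using 2 by (auto simp: \<sigma>_def)
    have d: "distributed M lborel X (normal_density 0 \<sigma>)" using 2 by (simp add: \<sigma>_def)
    interpret Q: prob_space "density lborel (normal_density (\<sigma>\<^sup>2) \<sigma>)"
      by (rule prob_space_normal_density[OF s(1)])
    have dQ: "distributed (density lborel (normal_density (\<sigma>\<^sup>2) \<sigma>)) lborel (\<lambda>x. x) (normal_density (\<sigma>\<^sup>2) \<sigma>)"
      unfolding distributed_def by (auto simp: distr_id2)
    have "integrable lborel (\<lambda>x. normal_density 0 \<sigma> x *\<^sub>R exp x)"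
      using s by (simp add: normal_density_times_exp)
    then have 1: "integrable M (\<lambda>\<omega>. exp (X \<omega>))"
      using distributed_integrable[OF d, of exp] by simp
    have dm: "distr M lborel X = density lborel (normal_density 0 \<sigma>)" using d by (simp add: distributed_def)
    have "(\<integral>\<omega>. of_real (exp (X \<omega>)) * iexp (a * X \<omega>) \<partial>M) = (\<integral>x. of_real (exp x) * iexp (a * x) \<partial>distr M lborel X)"
      by (subst integral_distr) auto
    also have "\<dots> = (\<integral>x. normal_density 0 \<sigma> x *\<^sub>R (of_real (exp x) * iexp (a * x)) \<partial>lborel)"
      unfolding dm by (subst integral_density) auto
    also have "\<dots> = (\<integral>x. of_real (exp (\<sigma>\<^sup>2/2)) * (normal_density (\<sigma>\<^sup>2) \<sigma> x *\<^sub>R iexp (a * x)) \<partial>lborel)"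
      using normal_density_times_exp[OF s(1)]
      by (intro Bochner_Integration.integral_cong) (auto simp: scaleR_conv_of_real mult.assoc[symmetric] simp flip: of_real_mult)
    also have "\<dots> = of_real (exp (\<sigma>\<^sup>2/2)) * (\<integral>x. normal_density (\<sigma>\<^sup>2) \<sigma> x *\<^sub>R iexp (a * x) \<partial>lborel)"
      by (rule integral_mult_right_zero)
    also have "(\<integral>x. normal_density (\<sigma>\<^sup>2) \<sigma> x *\<^sub>R iexp (a * x) \<partial>lborel) = (\<integral>x. iexp (a * x) \<partial>density lborel (normal_density (\<sigma>\<^sup>2) \<sigma>))"
      by (subst integral_density) auto
    also have "\<dots> = iexp (a * \<sigma>\<^sup>2) * exp (- of_real (a\<^sup>2 * \<sigma>\<^sup>2 / 2))"
      by (rule Q.normal_distributed_char[OF s(1) dQ])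
    finally show ?thesis using 1 unfolding s(2) by (simp only: mult.assoc simp_thms)
  qed
  then show "integrable M (\<lambda>\<omega>. exp (X \<omega>))"
    and "(\<integral>\<omega>. of_real (exp (X \<omega>)) * iexp (a * X \<omega>) \<partial>M) = of_real (exp (v/2)) * iexp (a * v) * exp (- of_real (a\<^sup>2 * v / 2))" by auto
qed

lemma (in prob_space) gaussian_char:
  assumes g: "real_gaussian M X" and X[measurable]: "X \<in> borel_measurable M"
    and m: "expectation X = 0" "expectation (\<lambda>\<omega>. (X \<omega>)\<^sup>2) = v"
  shows "(\<integral>\<omega>. iexp (X \<omega>) \<partial>M) = of_real (exp (- v / 2))"
  using g X m
proof (cases rule: centered_gaussian_cases)
  case 1
  have "(\<integral>\<omega>. iexp (X \<omega>) \<partial>M) = (\<integral>\<omega>. (1::complex) \<partial>M)"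
    by (rule integral_cong_AE) (use 1 in auto)
  then show ?thesis using 1 by (simp add: prob_space)
next
  case 2
  then show ?thesis using normal_distributed_char[of "sqrt v" X 0 1]
    by (simp flip: exp_of_real)
qed

lemma (in prob_space) gaussian_exp_expectation:
  assumes g: "real_gaussian M X" and X[measurable]: "X \<in> borel_measurable M"
    and m: "expectation X = 0" "expectation (\<lambda>\<omega>. (X \<omega>)\<^sup>2) = v"
  shows "integrable M (\<lambda>\<omega>. exp (X \<omega>))" "expectation (\<lambda>\<omega>. exp (X \<omega>)) = exp (v/2)"
proof -
  show 1: "integrable M (\<lambda>\<omega>. exp (X \<omega>))" by (rule gaussian_tilted_char[OF assms])
  have "complex_of_real (expectation (\<lambda>\<omega>. exp (X \<omega>))) = of_real (exp (v/2))"
    using gaussian_tilted_char(2)[OF assms, of 0] by simp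
  then show "expectation (\<lambda>\<omega>. exp (X \<omega>)) = exp (v/2)" by (simp only: of_real_eq_iff)
qed

text \<open>Decompose \<open>Y = b * X + R\<close> with \<open>R\<close> uncorrelated with \<open>X\<close>; then \<open>iexp R\<close> factors out of the expectation.\<close>

lemma (in prob_space) gaussian_pair_tilt:
  assumes g: "\<And>a b. real_gaussian M (\<lambda>\<omega>. a * X \<omega> + b * Y \<omega>)"
    and X[measurable]: "X \<in> borel_measurable M" and Y[measurable]: "Y \<in> borel_measurable M"
    and i: "integrable M X" "integrable M Y" "expectation X = 0" "expectation Y = 0"
    and i2: "integrable M (\<lambda>\<omega>. (X \<omega>)\<^sup>2)" "integrable M (\<lambda>\<omega>. (Y \<omega>)\<^sup>2)" "integrable M (\<lambda>\<omega>. X \<omega> * Y \<omega>)"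
    and v: "expectation (\<lambda>\<omega>. (X \<omega>)\<^sup>2) = s" "expectation (\<lambda>\<omega>. X \<omega> * Y \<omega>) = c" "expectation (\<lambda>\<omega>. (Y \<omega>)\<^sup>2) = r"
  shows "(\<integral>\<omega>. of_real (exp (X \<omega>)) * iexp (Y \<omega>) \<partial>M) = of_real (exp (s / 2)) * iexp c * of_real (exp (- r / 2))"
proof -
  \<comment> \<open>Linear combinations are Gaussian, so the joint characteristic function is the
    one-dimensional one at the variance of the combination.\<close>
  have ch: "(\<integral>\<omega>. iexp (a * X \<omega> + b * Y \<omega>) \<partial>M) = of_real (exp (- (a\<^sup>2 * s + 2 * a * b * c + b\<^sup>2 * r) / 2))" for a b
  proof (rule gaussian_char[OF g])
    have "expectation (\<lambda>\<omega>. (a * X \<omega> + b * Y \<omega>)\<^sup>2)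
      = expectation (\<lambda>\<omega>. a\<^sup>2 * (X \<omega>)\<^sup>2 + (2 * a * b) * (X \<omega> * Y \<omega>) + b\<^sup>2 * (Y \<omega>)\<^sup>2)"
      by (rule Bochner_Integration.integral_cong) (auto simp: power2_eq_square algebra_simps)
    also have "\<dots> = a\<^sup>2 * s + 2 * a * b * c + b\<^sup>2 * r" using i2 v by simp
    finally show "expectation (\<lambda>\<omega>. (a * X \<omega> + b * Y \<omega>)\<^sup>2) = a\<^sup>2 * s + 2 * a * b * c + b\<^sup>2 * r" .
  qed (use i in auto)
  have gX: "real_gaussian M X" using g[of 1 0] by simp
  show ?thesis
  proof (cases "s = 0")
    \<comment> \<open>With variance 0 there is no regression coefficient \<open>c / s\<close>; here
      \<open>X = 0\<close> almost surely and \<open>c = 0\<close>.\<close>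
    case True
    have "AE \<omega> in M. (X \<omega>)\<^sup>2 = 0"
      using integral_nonneg_eq_0_iff_AE[OF i2(1)] v(1) True by simp
    then have X0: "AE \<omega> in M. X \<omega> = 0" by simp
    have "c = expectation (\<lambda>_. 0)" unfolding v(2)[symmetric]
      by (rule integral_cong_AE) (use X0 in auto)
    moreover have "(\<integral>\<omega>. of_real (exp (X \<omega>)) * iexp (Y \<omega>) \<partial>M) = (\<integral>\<omega>. iexp (0 * X \<omega> + 1 * Y \<omega>) \<partial>M)"
      by (rule integral_cong_AE) (use X0 in auto)
    ultimately show ?thesis using True ch[of 0 1] by simp
  next
    case False
    \<comment> \<open>\<open>b\<close> is the regression coefficient of \<open>Y\<close> on
      \<open>X\<close> and \<open>\<tau>\<close> the residual variance. With this choice the joint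
      characteristic function of \<open>X\<close> and \<open>R\<close> is a product.\<close>
    define b where "b = c / s"
    define \<tau> where "\<tau> = r - c\<^sup>2 / s"
    define R where "R \<omega> = Y \<omega> - b * X \<omega>" for \<omega>
    have R[measurable]: "R \<in> borel_measurable M" unfolding R_def[abs_def] by measurable
    have chR: "(\<integral>\<omega>. iexp (a * X \<omega> + e * R \<omega>) \<partial>M) = of_real (exp (- (a\<^sup>2 * s) / 2) * exp (- (e\<^sup>2 * \<tau>) / 2))" for a e
    proof -
      have "(\<integral>\<omega>. iexp (a * X \<omega> + e * R \<omega>) \<partial>M) = (\<integral>\<omega>. iexp ((a - e * b) * X \<omega> + e * Y \<omega>) \<partial>M)"
        by (simp add: R_def algebra_simps)
      also have "\<dots> = of_real (exp (- ((a - e * b)\<^sup>2 * s + 2 * (a - e * b) * e * c + e\<^sup>2 * r) / 2))" by (rule ch)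
      also have "(a - e * b)\<^sup>2 * s + 2 * (a - e * b) * e * c + e\<^sup>2 * r = a\<^sup>2 * s + e\<^sup>2 * \<tau>"
        using False by (simp add: b_def \<tau>_def field_simps power2_eq_square)
      also have "exp (- (a\<^sup>2 * s + e\<^sup>2 * \<tau>) / 2) = exp (- (a\<^sup>2 * s) / 2) * exp (- (e\<^sup>2 * \<tau>) / 2)"
        by (simp add: add_divide_distrib diff_divide_distrib flip: exp_add)
      finally show ?thesis .
    qed
    have I: "integrable M (\<lambda>\<omega>. of_real 1 * iexp (a * X \<omega> + e * R \<omega>))" for a e
      by (rule integrable_const_bound[of _ 1]) auto
    have I0: "integrable M (\<lambda>\<omega>. iexp (a * X \<omega>))" for a
      by (rule integrable_const_bound[of _ 1]) auto
    \<comment> \<open>Everything in the integrand that depends on \<open>X\<close>: the exponential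
      weight and the regressed part of \<open>iexp Y\<close>.\<close>
    define h where "h x = complex_of_real (exp x) * iexp (b * x)" for x
    have [measurable]: "h \<in> borel_measurable borel" unfolding h_def[abs_def] by measurable
    have ih: "integrable M (\<lambda>\<omega>. w \<omega> * h (X \<omega>))" if [measurable]: "w \<in> borel_measurable M" and "\<And>\<omega>. cmod (w \<omega>) \<le> 2" for w
      by (rule Bochner_Integration.integrable_bound[OF integrable_mult_right[OF gaussian_tilted_char(1)[OF gX X i(3) v(1)], of 2]])
         (use that(2) in \<open>auto simp: h_def norm_mult intro!: AE_I2 mult_right_mono\<close>)
    have cb: "\<bar>1 + cos s\<bar> \<le> 2" for s :: real
      using cos_le_one[of s] cos_ge_minus_one[of s] by linarith
    have sb: "\<bar>1 + sin s\<bar> \<le> 2" for s :: real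
      using sin_le_one[of s] sin_ge_minus_one[of s] by linarith
    \<comment> \<open>Independence of \<open>R\<close> and \<open>X\<close>, expressed through
      weights: against functions of \<open>X\<close>, the weight \<open>1 + cos R\<close> acts like
      its mean \<open>1 + exp (- \<tau> / 2)\<close>. In \<open>Es\<close> the terms for 1 and -1
      cancel, and \<open>1 + sin R\<close> acts like 1.\<close>
    have Ec: "(\<integral>\<omega>. of_real (1 * (1 + cos (R \<omega>))) * h (X \<omega>) \<partial>M) = (\<integral>\<omega>. of_real (1 + exp (- \<tau> / 2)) * h (X \<omega>) \<partial>M)"
    proof (rule integral_vimage_eqI_char)
      show "integrable M (\<lambda>\<omega>. 1 * (1 + cos (R \<omega>)))"
        by (rule integrable_const_bound[of _ 2]) (use cb in auto)
      show "0 \<le> 1 * (1 + cos (R \<omega>))" for \<omega> unfolding mult_1_left using cos_ge_minus_one[of "R \<omega>"] by linarith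
      show "0 \<le> 1 + exp (- \<tau> / 2)" for \<omega> :: 'a by (simp add: add_nonneg_nonneg)
      fix a
      have "(\<integral>\<omega>. of_real (1 * (1 + cos (R \<omega>))) * iexp (a * X \<omega>) \<partial>M)
        = (\<integral>\<omega>. of_real 1 * iexp (a * X \<omega> + 0 * R \<omega>) + (1/2) * (of_real 1 * iexp (a * X \<omega> + 1 * R \<omega>))
               + (1/2) * (of_real 1 * iexp (a * X \<omega> + (-1) * R \<omega>)) \<partial>M)"
        by (rule Bochner_Integration.integral_cong[OF refl]) (rule one_plus_cos_times_iexp)
      also have "\<dots> = (\<integral>\<omega>. of_real 1 * iexp (a * X \<omega> + 0 * R \<omega>) \<partial>M) + (1/2) * (\<integral>\<omega>. of_real 1 * iexp (a * X \<omega> + 1 * R \<omega>) \<partial>M)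
          + (1/2) * (\<integral>\<omega>. of_real 1 * iexp (a * X \<omega> + (-1) * R \<omega>) \<partial>M)"
        by (rule integral_lincomb3[OF I I I])
      also have "\<dots> = of_real (1 + exp (- \<tau> / 2)) * of_real (exp (- (a\<^sup>2 * s) / 2))"
        unfolding of_real_1 mult_1_left[of "exp _"] chR by (simp add: algebra_simps)
      also have "\<dots> = (\<integral>\<omega>. of_real (1 + exp (- \<tau> / 2)) * iexp (a * X \<omega>) \<partial>M)"
        using chR[of a 0] by simp
      finally show "(\<integral>\<omega>. of_real (1 * (1 + cos (R \<omega>))) * iexp (a * X \<omega>) \<partial>M) = (\<integral>\<omega>. of_real (1 + exp (- \<tau> / 2)) * iexp (a * X \<omega>) \<partial>M)" .
    qed auto
    have Es: "(\<integral>\<omega>. of_real (1 * (1 + sin (R \<omega>))) * h (X \<omega>) \<partial>M) = (\<integral>\<omega>. of_real 1 * h (X \<omega>) \<partial>M)"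
    proof (rule integral_vimage_eqI_char)
      show "integrable M (\<lambda>\<omega>. 1 * (1 + sin (R \<omega>)))"
        by (rule integrable_const_bound[of _ 2]) (use sb in auto)
      show "0 \<le> 1 * (1 + sin (R \<omega>))" for \<omega> unfolding mult_1_left using sin_ge_minus_one[of "R \<omega>"] by linarith
      fix a
      have "(\<integral>\<omega>. of_real (1 * (1 + sin (R \<omega>))) * iexp (a * X \<omega>) \<partial>M)
        = (\<integral>\<omega>. of_real 1 * iexp (a * X \<omega> + 0 * R \<omega>) + (1/(2*\<i>)) * (of_real 1 * iexp (a * X \<omega> + 1 * R \<omega>))
               + (-1/(2*\<i>)) * (of_real 1 * iexp (a * X \<omega> + (-1) * R \<omega>)) \<partial>M)"
        by (rule Bochner_Integration.integral_cong[OF refl]) (rule one_plus_sin_times_iexp)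
      also have "\<dots> = (\<integral>\<omega>. of_real 1 * iexp (a * X \<omega> + 0 * R \<omega>) \<partial>M) + (1/(2*\<i>)) * (\<integral>\<omega>. of_real 1 * iexp (a * X \<omega> + 1 * R \<omega>) \<partial>M)
          + (-1/(2*\<i>)) * (\<integral>\<omega>. of_real 1 * iexp (a * X \<omega> + (-1) * R \<omega>) \<partial>M)"
        by (rule integral_lincomb3[OF I I I])
      also have "\<dots> = of_real (exp (- (a\<^sup>2 * s) / 2))"
        unfolding of_real_1 mult_1_left[of "exp _"] chR by (simp add: algebra_simps)
      also have "\<dots> = (\<integral>\<omega>. of_real 1 * iexp (a * X \<omega>) \<partial>M)"
        using chR[of a 0] by simp
      finally show "(\<integral>\<omega>. of_real (1 * (1 + sin (R \<omega>))) * iexp (a * X \<omega>) \<partial>M) = (\<integral>\<omega>. of_real 1 * iexp (a * X \<omega>) \<partial>M)" .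
    qed auto
    have i1: "integrable M (\<lambda>\<omega>. of_real (1 * (1 + cos (R \<omega>))) * h (X \<omega>))"
      by (rule ih) (use cb in \<open>auto simp del: of_real_add simp: norm_of_real\<close>)
    have i2: "integrable M (\<lambda>\<omega>. of_real (1 * (1 + sin (R \<omega>))) * h (X \<omega>))"
      by (rule ih) (use sb in \<open>auto simp del: of_real_add simp: norm_of_real\<close>)
    have i3: "integrable M (\<lambda>\<omega>. h (X \<omega>))"
      using ih[of "\<lambda>_. 1"] by simp
    have "(\<integral>\<omega>. of_real (exp (X \<omega>)) * iexp (Y \<omega>) \<partial>M) = (\<integral>\<omega>. iexp (R \<omega>) * h (X \<omega>) \<partial>M)"
      by (rule Bochner_Integration.integral_cong) (auto simp: R_def h_def algebra_simps simp flip: exp_add)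
    also have "\<dots> = (\<integral>\<omega>. of_real (1 * (1 + cos (R \<omega>))) * h (X \<omega>) + \<i> * (of_real (1 * (1 + sin (R \<omega>))) * h (X \<omega>))
         + (- (1 + \<i>)) * h (X \<omega>) \<partial>M)"
      unfolding iexp_eq_one_plus_trig by (rule Bochner_Integration.integral_cong) (auto simp: algebra_simps)
    also have "\<dots> = (\<integral>\<omega>. of_real (1 * (1 + cos (R \<omega>))) * h (X \<omega>) \<partial>M) + \<i> * (\<integral>\<omega>. of_real (1 * (1 + sin (R \<omega>))) * h (X \<omega>) \<partial>M)
         + (- (1 + \<i>)) * (\<integral>\<omega>. h (X \<omega>) \<partial>M)"
      by (rule integral_lincomb3[OF i1 i2 i3])
    also have "\<dots> = of_real (exp (- \<tau> / 2)) * (\<integral>\<omega>. h (X \<omega>) \<partial>M)"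
      unfolding Ec Es integral_mult_right_zero by (simp add: algebra_simps)
    also have "(\<integral>\<omega>. h (X \<omega>) \<partial>M) = of_real (exp (s/2)) * iexp (b * s) * exp (- of_real (b\<^sup>2 * s / 2))"
      unfolding h_def by (rule gaussian_tilted_char[OF gX X i(3) v(1)])
    also have "b * s = c" using False by (simp add: b_def)
    also have "b\<^sup>2 * s = r - \<tau>" using False by (simp add: b_def \<tau>_def power2_eq_square)
    also have "of_real (exp (- \<tau> / 2)) * (of_real (exp (s/2)) * iexp c * exp (- of_real ((r - \<tau>) / 2)))
      = of_real (exp (s / 2)) * iexp c * of_real (exp (- r / 2))"
      by (simp add: diff_divide_distrib algebra_simps flip: exp_of_real exp_add)
    finally show ?thesis .
  qed
qed

section \<open>Law of the tilted process\<close>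

lemma (in prob_space) expectation_sum_square:
  fixes X :: "'i \<Rightarrow> 'a \<Rightarrow> real"
  assumes "\<And>i j. i \<in> J \<Longrightarrow> j \<in> J \<Longrightarrow> integrable M (\<lambda>\<omega>. X i \<omega> * X j \<omega>)"
  shows "integrable M (\<lambda>\<omega>. (\<Sum>i\<in>J. c i * X i \<omega>)\<^sup>2)"
    and "expectation (\<lambda>\<omega>. (\<Sum>i\<in>J. c i * X i \<omega>)\<^sup>2) = (\<Sum>i\<in>J. \<Sum>j\<in>J. c i * c j * expectation (\<lambda>\<omega>. X i \<omega> * X j \<omega>))"
proof -
  have *: "(\<Sum>i\<in>J. c i * X i \<omega>)\<^sup>2 = (\<Sum>i\<in>J. \<Sum>j\<in>J. c i * c j * (X i \<omega> * X j \<omega>))" for \<omega>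
    by (simp add: power2_eq_square sum_product mult_ac)
  show "integrable M (\<lambda>\<omega>. (\<Sum>i\<in>J. c i * X i \<omega>)\<^sup>2)"
    unfolding * using assms by (intro Bochner_Integration.integrable_sum integrable_mult_right) auto
  show "expectation (\<lambda>\<omega>. (\<Sum>i\<in>J. c i * X i \<omega>)\<^sup>2) = (\<Sum>i\<in>J. \<Sum>j\<in>J. c i * c j * expectation (\<lambda>\<omega>. X i \<omega> * X j \<omega>))"
    unfolding * using assms
    by (subst Bochner_Integration.integral_sum, force intro!: Bochner_Integration.integrable_sum)
       (intro sum.cong refl, subst Bochner_Integration.integral_sum, auto)
qed

section \<open>Covariances, exponential moments and the shift of the process\<close>

locale fbm = prob_space M for M :: "'a measure" +
  fixes H :: real and W :: "real \<Rightarrow> 'a \<Rightarrow> real"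
  assumes fBm: "is_two_sided_fBm M H W" and H_ge: "1/2 \<le> H" and H_le: "H \<le> 1"
begin

definition pw :: "real \<Rightarrow> real" where "pw t = \<bar>t\<bar> powr (2 * H)"

definition L :: "real \<Rightarrow> 'a \<Rightarrow> real" where "L t \<omega> = W t \<omega> - pw t / 2"

lemma pw_0 [simp]: "pw 0 = 0" and pw_minus [simp]: "pw (- t) = pw t"
  and pw_nonneg [simp]: "0 \<le> pw t" and pw_minus_commute: "pw (s - t) = pw (t - s)"
  using H_ge by (simp_all add: pw_def abs_minus_commute)

lemma continuous_pw: "continuous_on S pw"
  unfolding pw_def[abs_def] using H_ge by (intro continuous_on_powr' continuous_intros) auto

lemma pw_measurable [measurable]: "pw \<in> borel_measurable borel"
  by (rule borel_measurable_continuous_onI[OF continuous_pw])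

lemma W_measurable [measurable]: "W t \<in> borel_measurable M"
  and W_continuous: "\<omega> \<in> space M \<Longrightarrow> continuous_on UNIV (\<lambda>t. W t \<omega>)"
  and W_0: "\<omega> \<in> space M \<Longrightarrow> W 0 \<omega> = 0"
  and W_integrable: "integrable M (W t)"
  and W_mean: "expectation (W t) = 0"
  and W_diff_square: "integrable M (\<lambda>\<omega>. (W s \<omega> - W t \<omega>)\<^sup>2)"
    "expectation (\<lambda>\<omega>. (W s \<omega> - W t \<omega>)\<^sup>2) = pw (s - t)"
  using fBm by (auto simp: is_two_sided_fBm_def pw_def)

lemma L_measurable [measurable]: "L t \<in> borel_measurable M"
  unfolding L_def[abs_def] by measurable

lemma L_continuous: "\<omega> \<in> space M \<Longrightarrow> continuous_on S (\<lambda>t. L t \<omega>)"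
  unfolding L_def
  by (intro continuous_intros continuous_pw continuous_on_subset[OF W_continuous]) auto

lemma W_sum_gaussian:
  assumes "finite J"
  shows "real_gaussian M (\<lambda>\<omega>. \<Sum>j\<in>J. c j * W (t j) \<omega>)"
proof -
  obtain xs where xs: "distinct xs" "set xs = J" using finite_distinct_list[OF assms] by auto
  have "(\<Sum>i<length (map t xs). map c xs ! i * W (map t xs ! i) \<omega>) = (\<Sum>j\<in>J. c j * W (t j) \<omega>)" for \<omega>
  proof -
    have "(\<Sum>j\<in>J. c j * W (t j) \<omega>) = sum_list (map (\<lambda>j. c j * W (t j) \<omega>) xs)"
      using xs by (simp add: sum.distinct_set_conv_list flip: xs(2))
    also have "\<dots> = (\<Sum>i<length xs. c (xs ! i) * W (t (xs ! i)) \<omega>)"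
      by (simp add: sum_list_sum_nth atLeast0LessThan)
    finally show ?thesis by simp
  qed
  then show ?thesis
    using fBm[unfolded is_two_sided_fBm_def, THEN conjunct2, THEN conjunct2, THEN conjunct2, THEN conjunct2, THEN conjunct1,
       rule_format, of "map t xs" "map c xs"] by simp
qed

text \<open>Polarisation of the increment variances. The base point \<open>r\<close> is arbitrary
  because the shifted process consists of increments from \<open>- t\<close>.\<close>

lemma W_increment_cov:
  shows "integrable M (\<lambda>\<omega>. (W s \<omega> - W r \<omega>) * (W t \<omega> - W r \<omega>))"
    and "expectation (\<lambda>\<omega>. (W s \<omega> - W r \<omega>) * (W t \<omega> - W r \<omega>)) = (pw (s - r) + pw (t - r) - pw (s - t)) / 2"
proof -
  have *: "(W s \<omega> - W r \<omega>) * (W t \<omega> - W r \<omega>)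
      = ((W s \<omega> - W r \<omega>)\<^sup>2 + (W t \<omega> - W r \<omega>)\<^sup>2 - (W s \<omega> - W t \<omega>)\<^sup>2) / 2" for \<omega>
    by (simp add: power2_eq_square algebra_simps)
  show "integrable M (\<lambda>\<omega>. (W s \<omega> - W r \<omega>) * (W t \<omega> - W r \<omega>))"
    unfolding * using W_diff_square by (intro integrable_divide) auto
  show "expectation (\<lambda>\<omega>. (W s \<omega> - W r \<omega>) * (W t \<omega> - W r \<omega>)) = (pw (s - r) + pw (t - r) - pw (s - t)) / 2"
    unfolding * using W_diff_square by simp
qed

lemma W_cov:
  shows "integrable M (\<lambda>\<omega>. W s \<omega> * W t \<omega>)"
    and "expectation (\<lambda>\<omega>. W s \<omega> * W t \<omega>) = (pw s + pw t - pw (s - t)) / 2"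
proof -
  have *: "W s \<omega> * W t \<omega> = (W s \<omega> - W 0 \<omega>) * (W t \<omega> - W 0 \<omega>)" if "\<omega> \<in> space M" for \<omega>
    by (simp add: W_0[OF that])
  show "integrable M (\<lambda>\<omega>. W s \<omega> * W t \<omega>)"
    using W_increment_cov(1)[of s 0 t] by (simp add: * cong: Bochner_Integration.integrable_cong)
  show "expectation (\<lambda>\<omega>. W s \<omega> * W t \<omega>) = (pw s + pw t - pw (s - t)) / 2"
    using W_increment_cov(2)[of s 0 t] by (simp add: * cong: Bochner_Integration.integral_cong)
qed

lemma exp_W_sum:
  assumes "finite J"
  shows "integrable M (\<lambda>\<omega>. exp (\<Sum>j\<in>J. c j * W (t j) \<omega>))"
    and "expectation (\<lambda>\<omega>. exp (\<Sum>j\<in>J. c j * W (t j) \<omega>))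
       = exp ((\<Sum>i\<in>J. \<Sum>j\<in>J. c i * c j * ((pw (t i) + pw (t j) - pw (t i - t j)) / 2)) / 2)"
proof -
  have m: "(\<lambda>\<omega>. \<Sum>j\<in>J. c j * W (t j) \<omega>) \<in> borel_measurable M" by measurable
  have e: "expectation (\<lambda>\<omega>. \<Sum>j\<in>J. c j * W (t j) \<omega>) = 0"
    by (subst Bochner_Integration.integral_sum) (auto simp: W_mean W_integrable)
  have v: "expectation (\<lambda>\<omega>. (\<Sum>j\<in>J. c j * W (t j) \<omega>)\<^sup>2)
       = (\<Sum>i\<in>J. \<Sum>j\<in>J. c i * c j * ((pw (t i) + pw (t j) - pw (t i - t j)) / 2))"
    by (subst expectation_sum_square(2)) (simp_all add: W_cov)
  show "integrable M (\<lambda>\<omega>. exp (\<Sum>j\<in>J. c j * W (t j) \<omega>))"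
    and "expectation (\<lambda>\<omega>. exp (\<Sum>j\<in>J. c j * W (t j) \<omega>))
       = exp ((\<Sum>i\<in>J. \<Sum>j\<in>J. c i * c j * ((pw (t i) + pw (t j) - pw (t i - t j)) / 2)) / 2)"
    using gaussian_exp_expectation[OF W_sum_gaussian[OF assms] m e v] by auto
qed

text \<open>The correction \<open>- pw t / 2\<close> makes each \<open>exp (L t)\<close> a
  probability density with respect to \<open>M\<close>; the change of measure uses this
  density.\<close>

lemma exp_L_1: "integrable M (\<lambda>\<omega>. exp (L t \<omega>))" "expectation (\<lambda>\<omega>. exp (L t \<omega>)) = 1"
proof -
  have *: "exp (L t \<omega>) = exp (- pw t / 2) * exp (\<Sum>j\<in>{()}. 1 * W t \<omega>)" for \<omega>
    by (simp add: L_def flip: exp_add)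
  show "integrable M (\<lambda>\<omega>. exp (L t \<omega>))" unfolding *
    by (intro integrable_mult_right exp_W_sum(1)) simp
  show "expectation (\<lambda>\<omega>. exp (L t \<omega>)) = 1" unfolding *
    by (subst integral_mult_right_zero, subst exp_W_sum(2)) (simp_all flip: exp_add)
qed

text \<open>One more time \<open>t\<close> is adjoined to the sum. It may coincide with some
  \<open>u j\<close>, so the index is tagged by \<open>option\<close> instead of taking a union of
  times.\<close>

lemma W_sum_option_gaussian:
  assumes "finite J"
  shows "real_gaussian M (\<lambda>\<omega>. a * W t \<omega> + b * (\<Sum>j\<in>J. c j * W (u j) \<omega>))"
proof -
  have "real_gaussian M (\<lambda>\<omega>. \<Sum>k\<in>insert None (Some ` J). (case k of None \<Rightarrow> a | Some j \<Rightarrow> b * c j) * W (case k of None \<Rightarrow> t | Some j \<Rightarrow> u j) \<omega>)"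
    by (rule W_sum_gaussian) (use assms in auto)
  also have "(\<lambda>\<omega>. \<Sum>k\<in>insert None (Some ` J). (case k of None \<Rightarrow> a | Some j \<Rightarrow> b * c j) * W (case k of None \<Rightarrow> t | Some j \<Rightarrow> u j) \<omega>)
     = (\<lambda>\<omega>. a * W t \<omega> + b * (\<Sum>j\<in>J. c j * W (u j) \<omega>))"
  proof
    fix \<omega> show "(\<Sum>k\<in>insert None (Some ` J). (case k of None \<Rightarrow> a | Some j \<Rightarrow> b * c j) * W (case k of None \<Rightarrow> t | Some j \<Rightarrow> u j) \<omega>)
        = a * W t \<omega> + b * (\<Sum>j\<in>J. c j * W (u j) \<omega>)"
      using assms by (subst sum.insert) (auto simp: sum.reindex sum_distrib_left mult_ac)
  qed
  finally show ?thesis .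
qed

text \<open>Both exponents are Gaussian with the same variance \<open>r\<close>, by stationarity of
  increments, so only the drifts need matching. On the left the drift is the covariance
  \<open>c\<close> with \<open>W t\<close> minus the deterministic part \<open>d\<close>; on the
  right it is the deterministic part \<open>d'\<close> of the increments of
  \<open>L\<close>.\<close>

lemma shift_char:
  assumes "finite J"
  shows "(\<integral>\<omega>. of_real (exp (L t \<omega>)) * iexp (\<Sum>j\<in>J. \<theta> j * L j \<omega>) \<partial>M)
       = (\<integral>\<omega>. of_real 1 * iexp (\<Sum>j\<in>J. \<theta> j * (L (j - t) \<omega> - L (- t) \<omega>)) \<partial>M)"
proof -
  define Y where "Y \<omega> = (\<Sum>j\<in>J. \<theta> j * W j \<omega>)" for \<omega>
  define Y' where "Y' \<omega> = (\<Sum>j\<in>J. \<theta> j * (W (j - t) \<omega> - W (- t) \<omega>))" for \<omega>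
  define r where "r = (\<Sum>i\<in>J. \<Sum>j\<in>J. \<theta> i * \<theta> j * ((pw i + pw j - pw (i - j)) / 2))"
  define c where "c = (\<Sum>j\<in>J. \<theta> j * ((pw t + pw j - pw (t - j)) / 2))"
  have Ym[measurable]: "Y \<in> borel_measurable M" "Y' \<in> borel_measurable M"
    unfolding Y_def[abs_def] Y'_def[abs_def] by measurable
  have Yi: "integrable M Y" "expectation Y = 0" "integrable M Y'" "expectation Y' = 0"
    unfolding Y_def[abs_def] Y'_def[abs_def]
    by (auto simp: Bochner_Integration.integral_sum W_mean W_integrable)
  have Y2: "integrable M (\<lambda>\<omega>. (Y \<omega>)\<^sup>2)" "expectation (\<lambda>\<omega>. (Y \<omega>)\<^sup>2) = r"
    unfolding Y_def r_def using expectation_sum_square[of J W \<theta>] by (simp_all add: W_cov)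
  have Y'2: "integrable M (\<lambda>\<omega>. (Y' \<omega>)\<^sup>2)" "expectation (\<lambda>\<omega>. (Y' \<omega>)\<^sup>2) = r"
    unfolding Y'_def r_def
    using expectation_sum_square[of J "\<lambda>j \<omega>. W (j - t) \<omega> - W (- t) \<omega>" \<theta>] by (simp_all add: W_increment_cov)
  have X2: "integrable M (\<lambda>\<omega>. (W t \<omega>)\<^sup>2)" "expectation (\<lambda>\<omega>. (W t \<omega>)\<^sup>2) = pw t"
    using W_cov[of t t] by (simp_all add: power2_eq_square)
  have XY: "integrable M (\<lambda>\<omega>. W t \<omega> * Y \<omega>)" "expectation (\<lambda>\<omega>. W t \<omega> * Y \<omega>) = c"
  proof -
    have *: "W t \<omega> * Y \<omega> = (\<Sum>j\<in>J. \<theta> j * (W t \<omega> * W j \<omega>))" for \<omega>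
      by (simp add: Y_def sum_distrib_left mult_ac)
    show "integrable M (\<lambda>\<omega>. W t \<omega> * Y \<omega>)" unfolding * using W_cov by auto
    show "expectation (\<lambda>\<omega>. W t \<omega> * Y \<omega>) = c" unfolding * c_def
      by (subst Bochner_Integration.integral_sum) (auto simp: W_cov)
  qed
  have g: "real_gaussian M (\<lambda>\<omega>. a * W t \<omega> + b * Y \<omega>)" for a b
    unfolding Y_def by (rule W_sum_option_gaussian[OF assms])
  have "real_gaussian M (\<lambda>\<omega>. (- (\<Sum>j\<in>J. \<theta> j)) * W (- t) \<omega> + 1 * (\<Sum>j\<in>J. \<theta> j * W (j - t) \<omega>))"
    by (rule W_sum_option_gaussian[OF assms])
  then have g': "real_gaussian M Y'"
    by (simp add: Y'_def[abs_def] right_diff_distrib sum_subtractf sum_distrib_right)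
  have 1: "(\<integral>\<omega>. of_real (exp (W t \<omega>)) * iexp (Y \<omega>) \<partial>M) = of_real (exp (pw t / 2)) * iexp c * of_real (exp (- r / 2))"
    by (rule gaussian_pair_tilt[OF g W_measurable Ym(1) W_integrable Yi(1) W_mean Yi(2) X2(1) Y2(1) XY(1) X2(2) XY(2) Y2(2)])
  have 2: "(\<integral>\<omega>. iexp (Y' \<omega>) \<partial>M) = of_real (exp (- r / 2))"
    by (rule gaussian_char[OF g' Ym(2) Yi(4) Y'2(2)])
  define d where "d = (\<Sum>j\<in>J. \<theta> j * (pw j / 2))"
  define d' where "d' = (\<Sum>j\<in>J. \<theta> j * ((pw t - pw (j - t)) / 2))"
  \<comment> \<open>Per coordinate: \<open>(pw t + pw j - pw (t - j)) / 2 - pw j / 2 = (pw t - pw (j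
    - t)) / 2\<close>.\<close>
  have dd: "c - d = d'" unfolding c_def d_def d'_def sum_subtractf[symmetric]
    by (rule sum.cong) (auto simp: field_simps pw_minus_commute)
  have "(\<integral>\<omega>. of_real (exp (L t \<omega>)) * iexp (\<Sum>j\<in>J. \<theta> j * L j \<omega>) \<partial>M)
     = (\<integral>\<omega>. (of_real (exp (- pw t / 2)) * iexp (- d)) * (of_real (exp (W t \<omega>)) * iexp (Y \<omega>)) \<partial>M)"
  proof (rule Bochner_Integration.integral_cong[OF refl])
    fix \<omega>
    have a: "(\<Sum>j\<in>J. \<theta> j * L j \<omega>) = - d + Y \<omega>"
      by (simp add: L_def d_def Y_def right_diff_distrib sum_subtractf)
    have b: "exp (L t \<omega>) = exp (- pw t / 2) * exp (W t \<omega>)" by (simp add: L_def flip: exp_add)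
    show "of_real (exp (L t \<omega>)) * iexp (\<Sum>j\<in>J. \<theta> j * L j \<omega>)
        = (of_real (exp (- pw t / 2)) * iexp (- d)) * (of_real (exp (W t \<omega>)) * iexp (Y \<omega>))"
      unfolding a b by (simp add: right_diff_distrib exp_diff exp_minus field_simps)
  qed
  also have "\<dots> = (of_real (exp (- pw t / 2)) * iexp (- d)) * (of_real (exp (pw t / 2)) * iexp c * of_real (exp (- r / 2)))"
    unfolding integral_mult_right_zero 1 ..
  also have "\<dots> = (of_real (exp (- pw t / 2)) * of_real (exp (pw t / 2))) * (iexp (- d) * iexp c) * of_real (exp (- r / 2))"
    by (simp only: mult_ac)
  also have "\<dots> = iexp d' * of_real (exp (- r / 2))"
    unfolding dd[symmetric] by (simp add: right_diff_distrib flip: exp_add of_real_mult)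
  also have "\<dots> = (\<integral>\<omega>. iexp d' * iexp (Y' \<omega>) \<partial>M)"
    unfolding integral_mult_right_zero 2 ..
  also have "\<dots> = (\<integral>\<omega>. of_real 1 * iexp (\<Sum>j\<in>J. \<theta> j * (L (j - t) \<omega> - L (- t) \<omega>)) \<partial>M)"
  proof (rule Bochner_Integration.integral_cong[OF refl])
    fix \<omega>
    have a: "(\<Sum>j\<in>J. \<theta> j * (L (j - t) \<omega> - L (- t) \<omega>)) = d' + Y' \<omega>"
      unfolding L_def d'_def Y'_def sum.distrib[symmetric] by (rule sum.cong) (auto simp: field_simps)
    show "iexp d' * iexp (Y' \<omega>) = of_real 1 * iexp (\<Sum>j\<in>J. \<theta> j * (L (j - t) \<omega> - L (- t) \<omega>))"
      unfolding a by (simp add: distrib_left flip: exp_add)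
  qed
  finally show ?thesis .
qed

text \<open>Finite-dimensional laws determine a finite measure on the product sigma-algebra, as
  cylinder sets generate it. Continuity of a function is not a measurable event there, so
  functionals of the path need a measurable form before this law can be applied to them.\<close>

lemma shift_law:
  "distr (density M (\<lambda>\<omega>. ennreal (exp (L t \<omega>)))) (PiM UNIV (\<lambda>_. borel)) (\<lambda>\<omega> u. L u \<omega>)
   = distr M (PiM UNIV (\<lambda>_. borel)) (\<lambda>\<omega> u. L (u - t) \<omega> - L (- t) \<omega>)"
  (is "distr ?M ?P ?X = distr M ?P ?Y")
proof (rule measure_eqI_PiM_infinite)
  have Xm[measurable]: "?X \<in> measurable M ?P" "?Y \<in> measurable M ?P"
    by (auto intro!: measurable_PiM_single')
  show "sets (distr ?M ?P ?X) = sets ?P" "sets (distr M ?P ?Y) = sets ?P" by simp_all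
  show "finite_measure (distr ?M ?P ?X)"
  proof (rule finite_measure.finite_measure_distr)
    show "finite_measure ?M"
      using exp_L_1 by (intro finite_measureI) (simp add: emeasure_density nn_integral_eq_integral cong: nn_integral_cong)
  qed auto
  fix A :: "real \<Rightarrow> real set" and J :: "real set"
  assume J: "finite J" "J \<subseteq> UNIV" and A: "\<And>i. i \<in> J \<Longrightarrow> A i \<in> sets borel"
  have [measurable]: "prod_emb UNIV (\<lambda>_. borel) J (Pi\<^sub>E J A) \<in> sets ?P"
    using J A by (intro sets_PiM_I) auto
  have iX: "(\<lambda>\<omega>. indicator (prod_emb UNIV (\<lambda>_. borel) J (Pi\<^sub>E J A)) (?X \<omega>) :: real) \<in> borel_measurable M"
    by (rule measurable_compose[OF Xm(1)]) measurable
  have iY: "(\<lambda>\<omega>. indicator (prod_emb UNIV (\<lambda>_. borel) J (Pi\<^sub>E J A)) (?Y \<omega>) :: real) \<in> borel_measurable M"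
    by (rule measurable_compose[OF Xm(2)]) measurable
  have ind: "indicator (prod_emb UNIV (\<lambda>_. borel) J (Pi\<^sub>E J A)) x = (\<Prod>j\<in>J. indicator (A j) (x j) :: real)" for x :: "real \<Rightarrow> real"
  proof (cases "\<forall>j\<in>J. x j \<in> A j")
    case True
    then show ?thesis by (auto simp: prod_emb_def indicator_def space_PiM)
  next
    case False
    then show ?thesis using J(1) by (auto simp: prod_emb_def indicator_def space_PiM prod_zero_iff restrict_PiE_iff)
  qed
  have "(\<integral>\<omega>. exp (L t \<omega>) * (\<Prod>j\<in>J. indicator (A j) (L j \<omega>)) \<partial>M)
      = (\<integral>\<omega>. 1 * (\<Prod>j\<in>J. indicator (A j) (L (j - t) \<omega> - L (- t) \<omega>)) \<partial>M)"
    using J A exp_L_1 shift_char[OF J(1), of t] by (intro joint_law_eqI_char) auto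
  then have eq: "(\<integral>\<omega>. exp (L t \<omega>) * indicator (prod_emb UNIV (\<lambda>_. borel) J (Pi\<^sub>E J A)) (?X \<omega>) \<partial>M)
      = (\<integral>\<omega>. indicator (prod_emb UNIV (\<lambda>_. borel) J (Pi\<^sub>E J A)) (?Y \<omega>) \<partial>M)"
    unfolding ind by simp
  have "emeasure (distr ?M ?P ?X) (prod_emb UNIV (\<lambda>_. borel) J (Pi\<^sub>E J A))
      = (\<integral>\<^sup>+x. indicator (prod_emb UNIV (\<lambda>_. borel) J (Pi\<^sub>E J A)) x \<partial>distr ?M ?P ?X)"
    by (subst nn_integral_indicator) auto
  also have "\<dots> = (\<integral>\<^sup>+\<omega>. ennreal (exp (L t \<omega>)) * indicator (prod_emb UNIV (\<lambda>_. borel) J (Pi\<^sub>E J A)) (?X \<omega>) \<partial>M)"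
    by (subst nn_integral_distr; (subst nn_integral_density)?) auto
  also have "\<dots> = (\<integral>\<^sup>+\<omega>. ennreal (exp (L t \<omega>) * indicator (prod_emb UNIV (\<lambda>_. borel) J (Pi\<^sub>E J A)) (?X \<omega>)) \<partial>M)"
    by (intro nn_integral_cong) (auto simp: ennreal_mult indicator_def)
  also have "\<dots> = ennreal (\<integral>\<omega>. exp (L t \<omega>) * indicator (prod_emb UNIV (\<lambda>_. borel) J (Pi\<^sub>E J A)) (?X \<omega>) \<partial>M)"
  proof (rule nn_integral_eq_integral)
    show "integrable M (\<lambda>\<omega>. exp (L t \<omega>) * indicator (prod_emb UNIV (\<lambda>_. borel) J (Pi\<^sub>E J A)) (?X \<omega>))"
      by (rule Bochner_Integration.integrable_bound[OF exp_L_1(1)[of t]]) (use iX in \<open>auto simp: indicator_def\<close>)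
  qed auto
  also have "\<dots> = ennreal (\<integral>\<omega>. indicator (prod_emb UNIV (\<lambda>_. borel) J (Pi\<^sub>E J A)) (?Y \<omega>) \<partial>M)"
    unfolding eq ..
  also have "\<dots> = (\<integral>\<^sup>+\<omega>. ennreal (indicator (prod_emb UNIV (\<lambda>_. borel) J (Pi\<^sub>E J A)) (?Y \<omega>)) \<partial>M)"
  proof (rule nn_integral_eq_integral[symmetric])
    show "integrable M (\<lambda>\<omega>. indicator (prod_emb UNIV (\<lambda>_. borel) J (Pi\<^sub>E J A)) (?Y \<omega>) :: real)"
      by (rule integrable_const_bound[of _ 1]) (use iY in \<open>auto simp: indicator_def\<close>)
  qed auto
  also have "\<dots> = (\<integral>\<^sup>+x. indicator (prod_emb UNIV (\<lambda>_. borel) J (Pi\<^sub>E J A)) x \<partial>distr M ?P ?Y)"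
    by (subst nn_integral_distr) (auto simp: ennreal_indicator)
  also have "\<dots> = emeasure (distr M ?P ?Y) (prod_emb UNIV (\<lambda>_. borel) J (Pi\<^sub>E J A))"
    by (subst nn_integral_indicator) auto
  finally show "emeasure (distr ?M ?P ?X) (prod_emb UNIV (\<lambda>_. borel) J (Pi\<^sub>E J A))
    = emeasure (distr M ?P ?Y) (prod_emb UNIV (\<lambda>_. borel) J (Pi\<^sub>E J A))" .
qed

end

section \<open>Dominating the tilted densities\<close>

text \<open>The null set in \<open>d\<close> is common to all \<open>m\<close>. Off it, the mean
  value inequality on the whole interval turns the bound \<open>K\<close> on the derivative into a
  bound on every difference quotient, and dominated convergence applies along sequences.\<close>

lemma has_real_derivative_integral:
  fixes f f' :: "real \<Rightarrow> 'a \<Rightarrow> real"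
  assumes f: "\<And>m. m \<in> {a<..<b} \<Longrightarrow> integrable M (f m)"
    and f'[measurable]: "\<And>m. m \<in> {a<..<b} \<Longrightarrow> f' m \<in> borel_measurable M"
    and d: "AE x in M. \<forall>m\<in>{a<..<b}. ((\<lambda>m. f m x) has_real_derivative f' m x) (at m) \<and> \<bar>f' m x\<bar> \<le> K x"
    and K: "integrable M K"
    and m: "m \<in> {a<..<b}"
  shows "((\<lambda>m. \<integral>x. f m x \<partial>M) has_real_derivative (\<integral>x. f' m x \<partial>M)) (at m)"
proof -
  have "((\<lambda>y. ((\<integral>x. f y x \<partial>M) - (\<integral>x. f m x \<partial>M)) / (y - m)) \<longlongrightarrow> (\<integral>x. f' m x \<partial>M)) (at m within {a<..<b})"
    unfolding tendsto_at_iff_sequentially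
  proof (intro allI impI)
    fix X assume X: "\<forall>i. X i \<in> {a<..<b} - {m}" "X \<longlonglongrightarrow> m"
    have "(\<lambda>i. \<integral>x. (f (X i) x - f m x) / (X i - m) \<partial>M) \<longlonglongrightarrow> (\<integral>x. f' m x \<partial>M)"
    proof (rule integral_dominated_convergence)
      show "AE x in M. (\<lambda>i. (f (X i) x - f m x) / (X i - m)) \<longlonglongrightarrow> f' m x"
        using d
      proof eventually_elim
        case (elim x)
        then have "((\<lambda>y. (f y x - f m x) / (y - m)) \<longlongrightarrow> f' m x) (at m)"
          using m by (auto simp: has_field_derivative_iff)
        then show ?case using X unfolding tendsto_at_iff_sequentially by (auto simp: comp_def)
      qed
      show "AE x in M. norm ((f (X i) x - f m x) / (X i - m)) \<le> K x" for i
        using d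
      proof eventually_elim
        case (elim x)
        have "norm (f (X i) x - f m x) \<le> K x * norm (X i - m)"
          by (rule field_differentiable_bound[where S="{a<..<b}" and f'="\<lambda>m. f' m x"])
             (use elim X m in \<open>auto intro: has_field_derivative_at_within\<close>)
        then show ?case using X(1)[rule_format, of i] by (simp add: field_simps)
      qed
      show "f' m \<in> borel_measurable M" using m by measurable
      show "(\<lambda>x. (f (X i) x - f m x) / (X i - m)) \<in> borel_measurable M" for i
        using f[of "X i"] f[OF m] X(1)[rule_format, of i] by auto
    qed (rule K)
    moreover have "(\<integral>x. (f (X i) x - f m x) / (X i - m) \<partial>M) = ((\<integral>x. f (X i) x \<partial>M) - (\<integral>x. f m x \<partial>M)) / (X i - m)" for i
      using f[of "X i"] f[OF m] X(1)[rule_format, of i] by simp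
    ultimately show "((\<lambda>y. ((\<integral>x. f y x \<partial>M) - (\<integral>x. f m x \<partial>M)) / (y - m)) \<circ> X) \<longlonglongrightarrow> (\<integral>x. f' m x \<partial>M)"
      by (simp only: comp_def)
  qed
  then show ?thesis using m at_within_open[of m "{a<..<b}"] by (simp add: has_field_derivative_iff)
qed

lemma continuous_on_integral_dominated:
  fixes f :: "real \<Rightarrow> 'a \<Rightarrow> real"
  assumes f[measurable]: "\<And>m. m \<in> S \<Longrightarrow> f m \<in> borel_measurable M"
    and d: "AE x in M. continuous_on S (\<lambda>m. f m x) \<and> (\<forall>m\<in>S. \<bar>f m x\<bar> \<le> K x)"
    and K: "integrable M K"
  shows "continuous_on S (\<lambda>m. \<integral>x. f m x \<partial>M)"
proof (rule continuous_on_sequentiallyI)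
  fix X m assume X: "\<forall>n. X n \<in> S" "m \<in> S" "X \<longlonglongrightarrow> m"
  show "(\<lambda>n. \<integral>x. f (X n) x \<partial>M) \<longlonglongrightarrow> (\<integral>x. f m x \<partial>M)"
  proof (rule integral_dominated_convergence[OF _ _ K])
    show "AE x in M. (\<lambda>i. f (X i) x) \<longlonglongrightarrow> f m x"
      using d
    proof eventually_elim
      case (elim x)
      then show ?case using X by (auto intro: continuous_on_tendsto_compose[of S "\<lambda>m. f m x"])
    qed
    show "AE x in M. norm (f (X i) x) \<le> K x" for i
      using d by eventually_elim (use X in auto)
  qed (use X f in auto)
qed

section \<open>Lower bounds for the normalising integral\<close>

definition unit_interval_towards_0 :: "real \<Rightarrow> real set" where
  "unit_interval_towards_0 u = (if u \<ge> 0 then {-1..0} else {0..1})"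

definition tail_kernel :: "(real \<Rightarrow> real) \<Rightarrow> real \<Rightarrow> real" where
  "tail_kernel l u = (LINT v:unit_interval_towards_0 u|lborel. exp (l u - l v / 2 - l (u + v) / 2))"

lemma set_integrable_continuous_interval:
  fixes f :: "real \<Rightarrow> real"
  shows "continuous_on UNIV f \<Longrightarrow> set_integrable lborel {a..b} f"
  by (intro borel_integrable_atLeastAtMost') (auto intro: continuous_on_subset)

lemma set_integrable_unit_interval:
  fixes f :: "real \<Rightarrow> real"
  shows "continuous_on UNIV f \<Longrightarrow> set_integrable lborel (unit_interval_towards_0 u) f"
  by (auto simp: unit_interval_towards_0_def set_integrable_continuous_interval)

text \<open>Jensen's inequality for the reciprocal on an interval of length 1. It replaces the
  reciprocal of an integral by an integral of reciprocals, whose expectation is a Gaussian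
  moment.\<close>

lemma integral_times_integral_inverse_ge_1:
  fixes s :: "real \<Rightarrow> real"
  assumes s: "continuous_on UNIV s" "\<And>v. s v > 0"
  shows "(LINT v:unit_interval_towards_0 u|lborel. s v) > 0"
    and "1 \<le> (LINT v:unit_interval_towards_0 u|lborel. s v) * (LINT v:unit_interval_towards_0 u|lborel. 1 / s v)"
proof -
  let ?I = "unit_interval_towards_0 u"
  define c where "c = (LINT v:?I|lborel. s v)"
  have i: "set_integrable lborel ?I s" "set_integrable lborel ?I (\<lambda>v. 1 / s v)"
    using s by (auto intro!: set_integrable_unit_interval continuous_intros simp: less_imp_neq[symmetric])
  have one: "(LINT v:?I|lborel. k) = k" for k :: real
    by (auto simp: unit_interval_towards_0_def set_lebesgue_integral_def)
  show c: "(LINT v:?I|lborel. s v) > 0"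
  proof -
    have m: "emeasure lborel ?I = 1" by (simp add: unit_interval_towards_0_def)
    have "(LINT v:?I|lborel. s v) \<noteq> 0"
    proof
      assume "(LINT v:?I|lborel. s v) = 0"
      then have "AE v in lborel. indicator ?I v *\<^sub>R s v = 0"
        using integral_nonneg_eq_0_iff_AE[OF i(1)[unfolded set_integrable_def]] s(2)
        by (auto simp: set_lebesgue_integral_def less_imp_le)
      then have "AE v in lborel. v \<notin> ?I"
        by eventually_elim (use s(2) in \<open>auto simp: indicator_def less_imp_neq[symmetric] split: if_splits\<close>)
      moreover have "?I \<in> sets lborel" by (simp add: unit_interval_towards_0_def)
      ultimately have "emeasure lborel ?I = 0" by (subst (asm) AE_iff_measurable[where N="?I"]) auto
      then show False using m by simp
    qed
    moreover have "(LINT v:?I|lborel. s v) \<ge> 0"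
      unfolding set_lebesgue_integral_def using s(2) by (intro integral_nonneg_AE) (auto simp: less_imp_le)
    ultimately show ?thesis by linarith
  qed
  have c': "c > 0" using c by (simp add: c_def)
  \<comment> \<open>AM-GM: \<open>2 \<le> s / c + c / s\<close> with \<open>c\<close> the mean of \<open>s\<close>\<close>
  have "(LINT v:?I|lborel. 2) \<le> (LINT v:?I|lborel. (1/c) * s v + c * (1 / s v))"
  proof (rule set_integral_mono)
    show "set_integrable lborel ?I (\<lambda>v. 2 :: real)"
      by (rule set_integrable_unit_interval) auto
    show "set_integrable lborel ?I (\<lambda>v. (1/c) * s v + c * (1 / s v))"
      using i by (intro set_integral_add set_integrable_mult_right) auto
    fix v
    have "0 \<le> (s v - c)\<^sup>2 / (c * s v)" using c' s(2)[of v] by simp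
    also have "\<dots> = (1/c) * s v + c * (1 / s v) - 2"
      using c' s(2)[of v] by (simp add: field_simps power2_eq_square)
    finally show "2 \<le> (1/c) * s v + c * (1 / s v)" by simp
  qed
  also have "\<dots> = (LINT v:?I|lborel. (1/c) * s v) + (LINT v:?I|lborel. c * (1 / s v))"
    using i by (intro set_integral_add set_integrable_mult_right) auto
  also have "\<dots> = (1/c) * c + c * (LINT v:?I|lborel. 1 / s v)"
    unfolding set_integral_mult_right c_def ..
  finally show "1 \<le> (LINT v:?I|lborel. s v) * (LINT v:?I|lborel. 1 / s v)"
    unfolding one c_def[symmetric] using c' by simp
qed

text \<open>The window \<open>[-N, N]\<close> contains the unit interval \<open>I\<close> at \<open>0\<close> as well as \<open>u + I\<close>, so the integral over it
  dominates the integral over \<open>I\<close> of the geometric mean of \<open>exp (l v)\<close> and \<open>exp (l (u + v))\<close>.\<close>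

lemma exp_le_tail_kernel:
  assumes l: "continuous_on UNIV l" and N: "1 \<le> N" "\<bar>u\<bar> \<le> N"
  shows "exp (l u) \<le> tail_kernel l u * (LINT v:{-N..N}|lborel. exp (l v))"
proof -
  let ?I = "unit_interval_towards_0 u"
  define s where "s v = exp ((l v + l (u + v)) / 2)" for v
  define B where "B = (LINT v:{-N..N}|lborel. exp (l v))"
  have lu: "continuous_on UNIV (\<lambda>v. l (u + v))"
    by (rule continuous_on_compose2[OF l]) (auto intro!: continuous_intros)
  have s: "continuous_on UNIV s" "\<And>v. s v > 0"
    unfolding s_def[abs_def] using l lu by (auto intro!: continuous_intros)
  have e: "continuous_on UNIV (\<lambda>v. exp (l v))" "continuous_on UNIV (\<lambda>v. exp (l (u + v)))"
    using l lu by (auto intro!: continuous_intros)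
  have i1: "set_integrable lborel {-N..N} (\<lambda>v. exp (l v))"
    by (rule set_integrable_continuous_interval[OF e(1)])
  \<comment> \<open>The same window integral in the variable \<open>u + v\<close>, so that both
    factors of the geometric mean can be compared with \<open>B\<close>.\<close>
  have B2: "B = (LINT v|lborel. indicator {-N..N} (u + v) * exp (l (u + v)))"
    unfolding B_def set_lebesgue_integral_def by (subst lborel_integral_real_affine[where c=1 and t=u]) auto
  have "integrable lborel (\<lambda>v. indicator {-N..N} (u + 1 * v) *\<^sub>R exp (l (u + 1 * v)))"
    by (rule lborel_integrable_real_affine[OF i1[unfolded set_integrable_def], of 1 u]) simp
  then have i2: "integrable lborel (\<lambda>v. indicator {-N..N} (u + v) * exp (l (u + v)))" by simp
  have "(LINT v:?I|lborel. s v) \<le> (LINT v|lborel. (1/2) * (indicator {-N..N} v * exp (l v)) + (1/2) * (indicator {-N..N} (u + v) * exp (l (u + v))))"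
    unfolding set_lebesgue_integral_def
  proof (rule integral_mono)
    show "integrable lborel (\<lambda>v. indicator ?I v *\<^sub>R s v)"
      using set_integrable_unit_interval[OF s(1), of u] by (simp add: set_integrable_def)
    show "integrable lborel (\<lambda>v. (1/2) * (indicator {-N..N} v * exp (l v)) + (1/2) * (indicator {-N..N} (u + v) * exp (l (u + v))))"
      using i1 i2 by (auto simp: set_integrable_def)
    fix v
    have "s v \<le> (exp (l v) + exp (l (u + v))) / 2"
    proof -
      have s2: "s v = exp (l v / 2) * exp (l (u + v) / 2)" by (simp add: s_def add_divide_distrib exp_add)
      have e2: "exp x = (exp (x/2))\<^sup>2" for x :: real by (simp flip: exp_double)
      show ?thesis unfolding s2 e2[of "l v"] e2[of "l (u + v)"]
        using sum_squares_bound[of "exp (l v / 2)" "exp (l (u + v) / 2)"] by simp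
    qed
    \<comment> \<open>\<open>?I\<close> lies on the side of 0 opposite to \<open>u\<close>, so
      \<open>u + v\<close> stays in the window even when \<open>u\<close> is at its edge;
      \<open>1 \<le> N\<close> takes care of \<open>v\<close>.\<close>
    then show "indicator ?I v *\<^sub>R s v \<le> (1/2) * (indicator {-N..N} v * exp (l v)) + (1/2) * (indicator {-N..N} (u + v) * exp (l (u + v)))"
      using N by (auto simp: unit_interval_towards_0_def indicator_def)
  qed
  also have "\<dots> = B"
    using i1 i2 by (simp add: set_integrable_def B2[symmetric] B_def[unfolded set_lebesgue_integral_def, symmetric, simplified])
  finally have sB: "(LINT v:?I|lborel. s v) \<le> B" .
  have q0: "(LINT v:?I|lborel. 1 / s v) \<ge> 0"
    unfolding set_lebesgue_integral_def using s(2) by (intro integral_nonneg_AE) (auto simp: less_imp_le)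
  have "1 \<le> (LINT v:?I|lborel. s v) * (LINT v:?I|lborel. 1 / s v)"
    by (rule integral_times_integral_inverse_ge_1[OF s])
  also have "\<dots> \<le> B * (LINT v:?I|lborel. 1 / s v)"
    by (rule mult_right_mono[OF sB q0])
  finally have "exp (l u) * 1 \<le> exp (l u) * (B * (LINT v:?I|lborel. 1 / s v))"
    by (intro mult_left_mono) auto
  also have "\<dots> = (LINT v:?I|lborel. exp (l u) * (1 / s v)) * B"
    by (simp only: set_integral_mult_right mult_ac)
  also have "(\<lambda>v. exp (l u) * (1 / s v)) = (\<lambda>v. exp (l u - l v / 2 - l (u + v) / 2))"
    by (simp add: s_def fun_eq_iff add_divide_distrib exp_diff exp_add)
  finally show ?thesis unfolding tail_kernel_def B_def by simp
qed

lemma tail_kernel_nonneg: "0 \<le> tail_kernel l u"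
  unfolding tail_kernel_def set_lebesgue_integral_def by (intro integral_nonneg_AE) auto

text \<open>The linear terms combine to \<open>m * u / 2 - m * v\<close>: half of the tilt at
  \<open>u\<close> cancels against the factor near \<open>u\<close>. With
  \<open>|m| \<le> 1/8\<close> and \<open>|v| \<le> 1\<close> this is at most
  \<open>|u| / 16 + 1/8\<close>.\<close>

lemma tail_kernel_tilt:
  assumes l: "continuous_on UNIV l" and m: "\<bar>m\<bar> \<le> 1/8"
  shows "tail_kernel (\<lambda>u. l u + m * u) u \<le> exp (1/8 + \<bar>u\<bar> / 16) * tail_kernel l u"
proof -
  let ?I = "unit_interval_towards_0 u"
  have lu: "continuous_on UNIV (\<lambda>v. l (u + v))"
    by (rule continuous_on_compose2[OF l]) (auto intro!: continuous_intros)
  have "tail_kernel (\<lambda>u. l u + m * u) u \<le> (LINT v:?I|lborel. exp (1/8 + \<bar>u\<bar> / 16) * exp (l u - l v / 2 - l (u + v) / 2))"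
    unfolding tail_kernel_def
  proof (rule set_integral_mono)
    show "set_integrable lborel ?I (\<lambda>v. exp (l u + m * u - (l v + m * v) / 2 - (l (u + v) + m * (u + v)) / 2))"
      "set_integrable lborel ?I (\<lambda>v. exp (1/8 + \<bar>u\<bar> / 16) * exp (l u - l v / 2 - l (u + v) / 2))"
      using l lu by (intro set_integrable_unit_interval continuous_intros; auto)+
    fix v assume "v \<in> ?I"
    then have v: "\<bar>v\<bar> \<le> 1" by (auto simp: unit_interval_towards_0_def split: if_splits)
    have "m * u \<le> 1/8 * \<bar>u\<bar>" "- (m * v) \<le> 1/8 * 1"
      using abs_le_D1[of "m * u" "1/8 * \<bar>u\<bar>"] abs_le_D2[of "m * v" "1/8 * 1"] mult_mono[OF m, of "\<bar>u\<bar>" "\<bar>u\<bar>"] mult_mono[OF m v]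
      by (auto simp: abs_mult)
    then have "l u + m * u - (l v + m * v) / 2 - (l (u + v) + m * (u + v)) / 2 \<le> (1/8 + \<bar>u\<bar> / 16) + (l u - l v / 2 - l (u + v) / 2)"
      by (simp add: field_simps)
    then show "exp (l u + m * u - (l v + m * v) / 2 - (l (u + v) + m * (u + v)) / 2) \<le> exp (1/8 + \<bar>u\<bar> / 16) * exp (l u - l v / 2 - l (u + v) / 2)"
      unfolding exp_add[symmetric] by simp
  qed
  then show ?thesis unfolding tail_kernel_def set_integral_mult_right .
qed

section \<open>Moments and logarithm of the mass for a single path\<close>

lemma abs_le_1_plus_square: "\<bar>u\<bar> \<le> 1 + (u::real)\<^sup>2"
  using sum_squares_bound[of "\<bar>u\<bar>" 1] by (simp add: power2_eq_square)

lemma power_le_1_plus_square: "k \<le> 2 \<Longrightarrow> \<bar>u ^ k\<bar> \<le> 1 + (u::real)\<^sup>2"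
  using abs_le_1_plus_square[of u] by (auto simp: le_Suc_eq numeral_2_eq_2)

text \<open>No probability is left here. The bound \<open>dom\<close> speaks of finite windows
  because convergence of the full integral is still to be derived from it, and the integral of a
  nonintegrable function would be 0.\<close>

locale dominated_tilt =
  fixes l G :: "real \<Rightarrow> real"
  assumes l: "continuous_on UNIV l"
    and G_nonneg: "\<And>u. 0 \<le> G u"
    and G: "integrable lborel (\<lambda>u. (1 + u\<^sup>2) * G u)"
    and dom: "\<And>m N u. \<bar>m\<bar> \<le> 1/8 \<Longrightarrow> 1 \<le> N \<Longrightarrow> \<bar>u\<bar> \<le> N \<Longrightarrow>
      exp (l u + m * u) \<le> G u * (LINT v:{-N..N}|lborel. exp (l v + m * v))"
begin

definition z :: "real \<Rightarrow> real \<Rightarrow> real" where "z m u = exp (l u + m * u)"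
definition K :: real where "K = (\<integral>u. (1 + u\<^sup>2) * G u \<partial>lborel)"
text \<open>A Chebyshev radius: \<open>K / R \<le> 1/2\<close>. It is linear in \<open>K\<close>, so
  that the factor \<open>exp R\<close> in a later bound for the mass has logarithm
  \<open>1 + 2 * K\<close>, which is integrable over the paths.\<close>

definition R :: real where "R = 1 + 2 * K"
definition B :: "real \<Rightarrow> real \<Rightarrow> real" where "B m N = (LINT v:{-N..N}|lborel. z m v)"
definition A :: "nat \<Rightarrow> real \<Rightarrow> real" where "A k m = (\<integral>u. u ^ k * z m u \<partial>lborel)"

lemma z_pos: "0 < z m u" by (simp add: z_def)

lemma z_continuous: "continuous_on UNIV (z m)"
  unfolding z_def[abs_def] using l by (intro continuous_intros)

lemma z_measurable [measurable]: "z m \<in> borel_measurable borel"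
  by (rule borel_measurable_continuous_onI[OF z_continuous])

lemma K_nonneg: "0 \<le> K"
  unfolding K_def using G_nonneg by (intro integral_nonneg_AE) auto

lemma R_pos: "0 < R" "1 \<le> R" using K_nonneg by (auto simp: R_def)

lemma z_window: "integrable lborel (\<lambda>v. indicator {-N..N} v * z m v)"
  using set_integrable_continuous_interval[OF z_continuous, of "-N" N m] by (simp add: set_integrable_def)

lemma B_eq: "B m N = (\<integral>v. indicator {-N..N} v * z m v \<partial>lborel)"
  by (simp add: B_def set_lebesgue_integral_def)

lemma B_nonneg: "0 \<le> B m N"
  unfolding B_eq by (intro integral_nonneg_AE) (auto simp: z_def)

lemma z_le_B: "\<bar>m\<bar> \<le> 1/8 \<Longrightarrow> 1 \<le> N \<Longrightarrow> \<bar>u\<bar> \<le> N \<Longrightarrow> z m u \<le> G u * B m N"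
  using dom[of m N u] by (simp add: z_def B_def)

text \<open>At most half of the mass lies outside \<open>[-R, R]\<close>; in particular \<open>z m\<close> has finite mass.\<close>

lemma mass_outside:
  assumes "f \<in> borel_measurable borel" "\<And>u. 0 \<le> f u" "integrable lborel f"
    and "\<And>u. f u \<le> z m u" "\<And>u. f u \<le> G u * integral\<^sup>L lborel f"
  shows "integral\<^sup>L lborel f \<le> 2 * B m R"
proof -
  let ?F = "integral\<^sup>L lborel f"
  have F0: "0 \<le> ?F" using assms by (intro integral_nonneg_AE) auto
  \<comment> \<open>Inside the radius \<open>f\<close> is bounded by \<open>z m\<close>; outside, by
    \<open>G\<close> times its own mass, with \<open>1 \<le> (1 + u\<^sup>2) / R\<close> inserted.
    The own mass returns with a factor at most 1/2 and is absorbed, being finite.\<close>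
  have "?F \<le> (\<integral>u. indicator {-R..R} u * z m u + ?F / R * ((1 + u\<^sup>2) * G u) \<partial>lborel)"
  proof (rule integral_mono[OF assms(3)])
    show "integrable lborel (\<lambda>u. indicator {-R..R} u * z m u + ?F / R * ((1 + u\<^sup>2) * G u))"
      using z_window G by (intro Bochner_Integration.integrable_add integrable_mult_right)
    fix u
    show "f u \<le> indicator {-R..R} u * z m u + ?F / R * ((1 + u\<^sup>2) * G u)"
    proof (cases "\<bar>u\<bar> \<le> R")
      case True
      have "0 \<le> ?F / R * ((1 + u\<^sup>2) * G u)" using F0 R_pos G_nonneg[of u] by simp
      then show ?thesis using True assms(4)[of u] by (auto simp: indicator_def abs_le_iff)
    next
      case False
      have "1 \<le> (1 + u\<^sup>2) / R" using False R_pos abs_le_1_plus_square[of u] by simp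
      then have "(G u * ?F) * 1 \<le> (G u * ?F) * ((1 + u\<^sup>2) / R)"
        using F0 G_nonneg[of u] by (intro mult_left_mono) auto
      then have "f u \<le> ?F / R * ((1 + u\<^sup>2) * G u)"
        using assms(5)[of u] by (simp add: field_simps)
      then show ?thesis using z_pos[of m u] by (auto simp: indicator_def intro: order_trans)
    qed
  qed
  also have "\<dots> = B m R + ?F / R * K"
    using z_window G by (simp add: B_eq K_def)
  also have "?F / R * K \<le> ?F / 2"
  proof -
    have "K / R \<le> 1 / 2" using R_pos by (simp add: R_def)
    then have "?F * (K / R) \<le> ?F * (1/2)" using F0 by (rule mult_left_mono)
    then show ?thesis by simp
  qed
  finally show ?thesis by simp
qed

text \<open>\<open>mass_outside\<close> for \<open>z m\<close> cut off to a window. The bound does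
  not depend on \<open>N\<close>, and from this the finiteness of the full mass follows.\<close>

lemma B_le: assumes "\<bar>m\<bar> \<le> 1/8" "1 \<le> N" shows "B m N \<le> 2 * B m R"
  unfolding B_eq[of m N]
proof (rule mass_outside)
  fix u show "indicator {- N..N} u * z m u \<le> G u * (\<integral>v. indicator {- N..N} v * z m v \<partial>lborel)"
    unfolding B_eq[symmetric] using z_le_B[OF assms, of u] G_nonneg[of u] B_nonneg[of m N]
    by (auto simp: indicator_def abs_le_iff)
qed (use z_window z_pos in \<open>auto simp: less_imp_le indicator_def\<close>)

lemma z_le_BR: assumes "\<bar>m\<bar> \<le> 1/8" shows "z m u \<le> G u * (2 * B m R)"
proof -
  \<comment> \<open>The smallest window that \<open>dom\<close> admits for the point
    \<open>u\<close>.\<close>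
  have "z m u \<le> G u * B m (max 1 \<bar>u\<bar>)" by (rule z_le_B[OF assms]) auto
  also have "\<dots> \<le> G u * (2 * B m R)" by (intro mult_left_mono B_le assms G_nonneg) auto
  finally show ?thesis .
qed

lemma square_z_integrable: assumes "\<bar>m\<bar> \<le> 1/8" shows "integrable lborel (\<lambda>u. (1 + u\<^sup>2) * z m u)"
proof (rule Bochner_Integration.integrable_bound[OF integrable_mult_right[OF G, of "2 * B m R"]])
  show "AE u in lborel. norm ((1 + u\<^sup>2) * z m u) \<le> norm (2 * B m R * ((1 + u\<^sup>2) * G u))"
  proof (rule AE_I2)
    fix u
    have "(1 + u\<^sup>2) * z m u \<le> (1 + u\<^sup>2) * (G u * (2 * B m R))"
      by (intro mult_left_mono z_le_BR assms) auto
    then show "norm ((1 + u\<^sup>2) * z m u) \<le> norm (2 * B m R * ((1 + u\<^sup>2) * G u))"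
      using z_pos[of m u] B_nonneg[of m R] G_nonneg[of u] by (simp add: abs_mult mult_ac)
  qed
qed measurable

lemma moment_integrable: 
  assumes "\<bar>m\<bar> \<le> 1/8" "k \<le> 2" shows "integrable lborel (\<lambda>u. u ^ k * z m u)"
  by (rule Bochner_Integration.integrable_bound[OF square_z_integrable[OF assms(1)]])
     (use power_le_1_plus_square[OF assms(2)] z_pos[of m] in \<open>auto simp: abs_mult intro!: mult_right_mono\<close>)

lemma z_integrable: "\<bar>m\<bar> \<le> 1/8 \<Longrightarrow> integrable lborel (z m)"
  using moment_integrable[of m 0] by simp

lemma A_0: "A 0 m = integral\<^sup>L lborel (z m)" by (simp add: A_def)

lemma z_le_A: assumes "\<bar>m\<bar> \<le> 1/8" shows "z m u \<le> G u * A 0 m"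
proof -
  have "z m u \<le> G u * B m (max 1 \<bar>u\<bar>)" by (rule z_le_B[OF assms]) auto
  also have "B m (max 1 \<bar>u\<bar>) \<le> A 0 m" unfolding B_eq A_0
    by (rule integral_mono[OF z_window z_integrable[OF assms]]) (use z_pos in \<open>auto simp: indicator_def less_imp_le\<close>)
  finally show ?thesis using G_nonneg[of u] by (simp add: mult_left_mono)
qed

lemma A_pos: assumes "\<bar>m\<bar> \<le> 1/8" shows "0 < A 0 m"
  using less_le_trans[OF z_pos z_le_A[OF assms, of 0]] G_nonneg[of 0] by (simp add: zero_less_mult_iff)

text \<open>Reducing the mass to a bounded window allows a damping factor \<open>exp (- |u|)\<close>
  to be inserted at the price \<open>exp R\<close>.\<close>

lemma A_0_le: assumes "\<bar>m\<bar> \<le> 1/8" shows "A 0 m \<le> 2 * B m R"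
  unfolding A_0 by (rule mass_outside) (use z_pos z_integrable z_le_A assms in \<open>auto simp: less_imp_le A_0\<close>)

text \<open>The normaliser cancels, so the bound is free of \<open>m\<close>. As a function of the
  path, \<open>K\<close> is integrable, and it serves as the majorant under the expectation.\<close>

lemma A_quotient_le: assumes "\<bar>m\<bar> \<le> 1/8" "k \<le> 2" shows "\<bar>A k m / A 0 m\<bar> \<le> K"
proof -
  have "\<bar>A k m\<bar> \<le> (\<integral>u. \<bar>u ^ k * z m u\<bar> \<partial>lborel)" unfolding A_def by (rule integral_abs_bound)
  also have "\<dots> \<le> (\<integral>u. A 0 m * ((1 + u\<^sup>2) * G u) \<partial>lborel)"
  proof (rule integral_mono)
    show "integrable lborel (\<lambda>u. \<bar>u ^ k * z m u\<bar>)" using moment_integrable[OF assms] by (rule integrable_abs)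
    show "integrable lborel (\<lambda>u. A 0 m * ((1 + u\<^sup>2) * G u))" using G by (rule integrable_mult_right)
    fix u
    have "\<bar>u ^ k\<bar> * z m u \<le> (1 + u\<^sup>2) * (G u * A 0 m)"
      using power_le_1_plus_square[OF assms(2), of u] z_le_A[OF assms(1), of u] z_pos[of m u]
      by (intro mult_mono) auto
    then show "\<bar>u ^ k * z m u\<bar> \<le> A 0 m * ((1 + u\<^sup>2) * G u)"
      using z_pos[of m u] by (simp add: abs_mult mult_ac)
  qed
  also have "\<dots> = A 0 m * K" by (simp add: K_def)
  finally show ?thesis using A_pos[OF assms(1)] by (simp add: abs_mult field_simps)
qed

text \<open>Differentiating the unnormalised moments requires a majorant without \<open>m\<close>,
  while \<open>z_le_A\<close> still contains \<open>A 0 m\<close>. Since \<open>m * u\<close> is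
  monotone in \<open>m\<close>, it is largest at one of the ends 1/8 and -1/8, where
  \<open>z\<close> is already dominated.\<close>

lemma z_uniform_bound: 
  assumes "\<bar>m\<bar> \<le> 1/8" shows "z m u \<le> (A 0 (1/8) + A 0 (-1/8)) * G u"
proof -
  have "m * u \<le> max (1/8 * u) (-1/8 * u)"
    using assms mult_right_mono[of m "1/8" u] mult_right_mono_neg[of "-1/8" m u]
    by (cases "0 \<le> u") (auto simp: abs_le_iff le_max_iff_disj)
  then have "z m u \<le> max (z (1/8) u) (z (-1/8) u)"
    by (auto simp: z_def max_def split: if_splits)
  also have "\<dots> \<le> z (1/8) u + z (-1/8) u" using z_pos[of "1/8" u] z_pos[of "-1/8" u] by auto
  also have "\<dots> \<le> G u * A 0 (1/8) + G u * A 0 (-1/8)" by (intro add_mono z_le_A) auto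
  finally show ?thesis by (simp add: algebra_simps)
qed

lemma moment_dominated:
  assumes "\<bar>m\<bar> \<le> 1/8" "k \<le> 2"
  shows "\<bar>u ^ k * z m u\<bar> \<le> (A 0 (1/8) + A 0 (-1/8)) * ((1 + u\<^sup>2) * G u)"
proof -
  have "\<bar>u ^ k\<bar> * z m u \<le> (1 + u\<^sup>2) * ((A 0 (1/8) + A 0 (-1/8)) * G u)"
    using power_le_1_plus_square[OF assms(2), of u] z_uniform_bound[OF assms(1), of u] z_pos[of m u]
    by (intro mult_mono) auto
  then show ?thesis using z_pos[of m u] by (simp add: abs_mult mult_ac)
qed

lemma A_has_derivative:
  assumes "m \<in> {-1/8<..<1/8}" "k < 2" shows "(A k has_real_derivative A (Suc k) m) (at m)"
  unfolding A_def[abs_def]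
proof (rule has_real_derivative_integral[where a="-1/8" and b="1/8"])
  show "AE x in lborel. \<forall>m\<in>{- 1 / 8<..<1 / 8}. ((\<lambda>m. x ^ k * z m x) has_real_derivative x ^ Suc k * z m x) (at m) \<and>
           \<bar>x ^ Suc k * z m x\<bar> \<le> (A 0 (1/8) + A 0 (-1/8)) * ((1 + x\<^sup>2) * G x)"
  proof (intro AE_I2 ballI conjI)
    fix x m :: real assume m: "m \<in> {-1/8<..<1/8}"
    show "((\<lambda>m. x ^ k * z m x) has_real_derivative x ^ Suc k * z m x) (at m)"
      unfolding z_def by (auto intro!: derivative_eq_intros)
    show "\<bar>x ^ Suc k * z m x\<bar> \<le> (A 0 (1/8) + A 0 (-1/8)) * ((1 + x\<^sup>2) * G x)"
      by (rule moment_dominated) (use m assms in auto)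
  qed
  show "integrable lborel (\<lambda>u. (A 0 (1/8) + A 0 (-1/8)) * ((1 + u\<^sup>2) * G u))" using G by (rule integrable_mult_right)
qed (use assms in \<open>auto intro!: moment_integrable\<close>)

lemma A_continuous: assumes "k \<le> 2" shows "continuous_on {-1/8<..<1/8} (A k)"
  unfolding A_def[abs_def]
proof (rule continuous_on_integral_dominated)
  show "AE x in lborel. continuous_on {-1/8<..<1/8} (\<lambda>m. x ^ k * z m x) \<and>
     (\<forall>m\<in>{-1/8<..<1/8}. \<bar>x ^ k * z m x\<bar> \<le> (A 0 (1/8) + A 0 (-1/8)) * ((1 + x\<^sup>2) * G x))"
  proof (intro AE_I2 ballI conjI)
    fix x m :: real
    show "continuous_on {-1/8<..<1/8} (\<lambda>m. x ^ k * z m x)"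
      unfolding z_def by (intro continuous_intros)
    assume m: "m \<in> {-1/8<..<1/8}"
    show "\<bar>x ^ k * z m x\<bar> \<le> (A 0 (1/8) + A 0 (-1/8)) * ((1 + x\<^sup>2) * G x)"
      by (rule moment_dominated) (use m assms in auto)
  qed
  show "integrable lborel (\<lambda>u. (A 0 (1/8) + A 0 (-1/8)) * ((1 + u\<^sup>2) * G u))" using G by (rule integrable_mult_right)
qed auto

lemma ln_A_derivative:
  assumes "m \<in> {-1/8<..<1/8}"
  shows "((\<lambda>m. ln (A 0 m)) has_real_derivative A 1 m / A 0 m) (at m)"
    "((\<lambda>m. A 1 m / A 0 m) has_real_derivative A 2 m / A 0 m - (A 1 m / A 0 m)\<^sup>2) (at m)"
proof -
  have p: "0 < A 0 m" by (rule A_pos) (use assms in auto)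
  note d0 = A_has_derivative[OF assms, of 0, simplified]
  note d1 = A_has_derivative[OF assms, of 1, simplified]
  show "((\<lambda>m. ln (A 0 m)) has_real_derivative A 1 m / A 0 m) (at m)"
    using d0 p by (auto intro!: derivative_eq_intros simp: field_simps)
  show "((\<lambda>m. A 1 m / A 0 m) has_real_derivative A 2 m / A 0 m - (A 1 m / A 0 m)\<^sup>2) (at m)"
    using d0 d1 p by (auto intro!: derivative_eq_intros simp: field_simps power2_eq_square numeral_2_eq_2)
qed

text \<open>Bias-variance decomposition. The mean as centre shows that the variance is nonnegative;
  other centres supply the mean square errors in the variance identity.\<close>

lemma centered_second_moment:
  assumes m: "\<bar>m\<bar> \<le> 1/8"
  shows "integrable lborel (\<lambda>u. (c - u)\<^sup>2 * (z m u / A 0 m))"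
    and "(\<integral>u. (c - u)\<^sup>2 * (z m u / A 0 m) \<partial>lborel) = A 2 m / A 0 m - (A 1 m / A 0 m)\<^sup>2 + (c - A 1 m / A 0 m)\<^sup>2"
proof -
  have p: "0 < A 0 m" by (rule A_pos) (use assms in auto)
  have i: "integrable lborel (\<lambda>u. u ^ 0 * z m u)" "integrable lborel (\<lambda>u. u ^ 1 * z m u)" "integrable lborel (\<lambda>u. u ^ 2 * z m u)"
    by (intro moment_integrable m; simp)+
  have e: "(c - u)\<^sup>2 * (z m u / A 0 m) = (c\<^sup>2 / A 0 m) * (u ^ 0 * z m u) + (- 2 * c / A 0 m) * (u ^ 1 * z m u) + (1 / A 0 m) * (u ^ 2 * z m u)" for u
    by (simp add: power2_eq_square algebra_simps add_divide_distrib diff_divide_distrib)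
  show "integrable lborel (\<lambda>u. (c - u)\<^sup>2 * (z m u / A 0 m))" unfolding e
    using i by (intro Bochner_Integration.integrable_add integrable_mult_right)
  have "(\<integral>u. (c - u)\<^sup>2 * (z m u / A 0 m) \<partial>lborel)
      = (c\<^sup>2 / A 0 m) * A 0 m + (- 2 * c / A 0 m) * A 1 m + (1 / A 0 m) * A 2 m"
    unfolding e
    by (simp only: Bochner_Integration.integral_add[OF Bochner_Integration.integrable_add[OF integrable_mult_right[OF i(1)] integrable_mult_right[OF i(2)]] integrable_mult_right[OF i(3)]]
       Bochner_Integration.integral_add[OF integrable_mult_right[OF i(1)] integrable_mult_right[OF i(2)]]
       integral_mult_right_zero A_def[symmetric])
  also have "\<dots> = A 2 m / A 0 m - (A 1 m / A 0 m)\<^sup>2 + (c - A 1 m / A 0 m)\<^sup>2"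
    using p by (simp add: power2_eq_square field_simps)
  finally show "(\<integral>u. (c - u)\<^sup>2 * (z m u / A 0 m) \<partial>lborel) = A 2 m / A 0 m - (A 1 m / A 0 m)\<^sup>2 + (c - A 1 m / A 0 m)\<^sup>2" .
qed

lemma variance_bounds:
  assumes m: "\<bar>m\<bar> \<le> 1/8"
  shows "0 \<le> A 2 m / A 0 m - (A 1 m / A 0 m)\<^sup>2" "A 2 m / A 0 m - (A 1 m / A 0 m)\<^sup>2 \<le> K" "(A 1 m / A 0 m)\<^sup>2 \<le> K"
proof -
  have "0 \<le> (\<integral>u. (A 1 m / A 0 m - u)\<^sup>2 * (z m u / A 0 m) \<partial>lborel)"
    using z_pos[of m] A_pos[OF m] by (intro integral_nonneg_AE) (auto intro!: AE_I2 simp: less_imp_le)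
  then show 0: "0 \<le> A 2 m / A 0 m - (A 1 m / A 0 m)\<^sup>2"
    unfolding centered_second_moment(2)[OF m] by simp
  have "A 2 m / A 0 m \<le> K" using abs_le_D1[OF A_quotient_le[OF m, of 2]] by simp
  then show "A 2 m / A 0 m - (A 1 m / A 0 m)\<^sup>2 \<le> K" "(A 1 m / A 0 m)\<^sup>2 \<le> K"
    using 0 zero_le_power2[of "A 1 m / A 0 m"] by linarith+
qed

text \<open>Both integrals on the right will have finite expectation, unlike the mass itself. Above,
  the window of radius \<open>R\<close> is damped at the price \<open>exp R\<close>, of which the
  logarithm keeps only \<open>R\<close>. Below, Jensen's inequality on \<open>{0..1}\<close> bounds
  \<open>1 / A 0 0\<close>.\<close>

lemma ln_A_0_bound:
  assumes X: "integrable lborel (\<lambda>u. exp (l u - \<bar>u\<bar>))"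
  shows "\<bar>ln (A 0 0)\<bar> \<le> 2 + 2 * K + (\<integral>u. exp (l u - \<bar>u\<bar>) \<partial>lborel) + (LINT v:{0..1}|lborel. exp (- l v))"
proof -
  let ?X = "\<integral>u. exp (l u - \<bar>u\<bar>) \<partial>lborel" and ?Y = "LINT v:{0..1}|lborel. exp (- l v)"
  have p: "0 < A 0 0" by (rule A_pos) auto
  have X0: "0 \<le> ?X" by (intro integral_nonneg_AE) auto
  have Y0: "0 \<le> ?Y" unfolding set_lebesgue_integral_def by (intro integral_nonneg_AE) auto
  have "B 0 R \<le> (\<integral>u. exp R * exp (l u - \<bar>u\<bar>) \<partial>lborel)" unfolding B_eq
  proof (rule integral_mono[OF z_window])
    fix u show "indicator {- R..R} u * z 0 u \<le> exp R * exp (l u - \<bar>u\<bar>)"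
      by (auto simp: indicator_def z_def simp flip: exp_add)
  qed (use X in simp)
  then have "A 0 0 \<le> 2 * (exp R * ?X)" using A_0_le[of 0] by simp
  moreover from this p have Xp: "0 < ?X" by (intro le_neq_trans[OF X0]) auto
  ultimately have "ln (A 0 0) \<le> ln (2 * (exp R * ?X))" using p by simp
  also have "\<dots> = ln 2 + R + ln ?X" using Xp by (simp add: ln_mult)
  also have "\<dots> \<le> 1 + R + ?X" using ln_le_minus_one[of "2::real"] ln_bound[OF Xp] by simp
  finally have up: "ln (A 0 0) \<le> 2 + 2 * K + ?X" by (simp add: R_def)
  have c: "continuous_on UNIV (\<lambda>v. exp (l v))" using l by (intro continuous_intros)
  \<comment> \<open>Any negative argument selects \<open>{0..1}\<close>; the value -1 has no other
    meaning.\<close>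
  have I: "unit_interval_towards_0 (-1) = {0..1}" by (simp add: unit_interval_towards_0_def)
  have "1 \<le> (LINT v:{0..1}|lborel. exp (l v)) * (LINT v:{0..1}|lborel. 1 / exp (l v))"
    using integral_times_integral_inverse_ge_1(2)[OF c, of "-1"] by (simp add: I)
  also have "(\<lambda>v. 1 / exp (l v)) = (\<lambda>v. exp (- l v))" by (simp add: exp_minus field_simps)
  also have "(LINT v:{0..1}|lborel. exp (l v)) \<le> A 0 0"
    unfolding set_lebesgue_integral_def A_0
    by (rule integral_mono)
       (use set_integrable_continuous_interval[OF c, of 0 1] z_integrable[of 0] in \<open>auto simp: set_integrable_def z_def indicator_def\<close>)
  finally have "1 \<le> A 0 0 * ?Y" using Y0 by (simp add: mult_right_mono)
  then have "1 / A 0 0 \<le> ?Y" using p by (simp add: field_simps)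
  moreover have "- ln (A 0 0) \<le> 1 / A 0 0"
    using ln_bound[of "1 / A 0 0"] p by (simp add: ln_div)
  ultimately show ?thesis using up K_nonneg X0 Y0 by (intro abs_leI) linarith+
qed

end

section \<open>Integrability of the dominating function\<close>

text \<open>Evaluation of a path at dyadic approximations: it agrees with evaluation on continuous paths and,
  unlike evaluation itself, is jointly measurable for the product \<open>\<sigma>\<close>-algebra.\<close>

definition path_eval :: "real \<Rightarrow> (real \<Rightarrow> real) \<Rightarrow> real" where
  "path_eval u x = lim (\<lambda>k. x (of_int \<lfloor>2 ^ k * u\<rfloor> / 2 ^ k))"

lemma floor_dyadic_tendsto: "(\<lambda>k. of_int \<lfloor>2 ^ k * u\<rfloor> / 2 ^ k) \<longlonglongrightarrow> (u::real)"
proof -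
  have 1: "(\<lambda>k. u - (1/2) ^ k) \<longlonglongrightarrow> u - 0"
    by (intro tendsto_intros LIMSEQ_power_zero) auto
  have b: "u - (1/2) ^ k \<le> of_int \<lfloor>2 ^ k * u\<rfloor> / 2 ^ k" "of_int \<lfloor>2 ^ k * u\<rfloor> / 2 ^ k \<le> u" for k :: nat
  proof -
    have 1: "2 ^ k * u - 1 \<le> of_int \<lfloor>2 ^ k * u\<rfloor>" "of_int \<lfloor>2 ^ k * u\<rfloor> \<le> 2 ^ k * u" by linarith+
    have "u - (1/2) ^ k = (2 ^ k * u - 1) / 2 ^ k" by (simp add: diff_divide_distrib power_one_over)
    also have "\<dots> \<le> of_int \<lfloor>2 ^ k * u\<rfloor> / 2 ^ k" using 1(1) by (intro divide_right_mono) auto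
    finally show "u - (1/2) ^ k \<le> of_int \<lfloor>2 ^ k * u\<rfloor> / 2 ^ k" .
    show "of_int \<lfloor>2 ^ k * u\<rfloor> / 2 ^ k \<le> u" using 1(2) by (simp add: field_simps)
  qed
  show ?thesis by (rule tendsto_sandwich[OF _ _ 1[simplified] tendsto_const]) (use b in auto)
qed

lemma path_eval_continuous: "continuous_on UNIV x \<Longrightarrow> path_eval u x = x u"
  unfolding path_eval_def
  by (intro limI continuous_on_tendsto_compose[OF _ floor_dyadic_tendsto]) auto

text \<open>At each dyadic level only countably many times occur. On each level set of the floor the
  approximant is a single coordinate, hence measurable, and the limit inherits this.\<close>

lemma path_eval_measurable:
  "(\<lambda>(u, x). path_eval u x) \<in> borel_measurable (borel \<Otimes>\<^sub>M PiM UNIV (\<lambda>_. borel))"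
proof -
  have "(\<lambda>p :: real \<times> (real \<Rightarrow> real). snd p (of_int \<lfloor>2 ^ k * fst p\<rfloor> / 2 ^ k)) \<in> borel_measurable (borel \<Otimes>\<^sub>M PiM UNIV (\<lambda>_. borel :: real measure))" for k :: nat
  proof (rule measurable_compose_countable[where g="\<lambda>p :: real \<times> (real \<Rightarrow> real). \<lfloor>2 ^ k * fst p\<rfloor>" and f="\<lambda>i p. snd p (of_int i / 2 ^ k)"])
    show "(\<lambda>p. snd p (of_int i / 2 ^ k)) \<in> borel_measurable (borel \<Otimes>\<^sub>M PiM UNIV (\<lambda>_. borel :: real measure))" for i :: int
      by (rule measurable_compose[OF measurable_snd]) simp
  qed measurable
  then show ?thesis unfolding path_eval_def case_prod_beta' by (rule borel_measurable_lim_metric)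
qed

lemma path_eval_measurable' [measurable (raw)]:
  assumes "f \<in> borel_measurable N" "g \<in> measurable N (PiM UNIV (\<lambda>_. borel))"
  shows "(\<lambda>x. path_eval (f x) (g x)) \<in> borel_measurable N"
  using measurable_compose[OF measurable_Pair[OF assms] path_eval_measurable] by simp

section \<open>Exponential integrals and a parallelogram inequality for powers\<close>

lemma integrable_exp_abs:
  assumes "0 < a" shows "integrable lborel (\<lambda>u::real. exp (- a * \<bar>u\<bar>))"
proof -
  interpret prob_space "density lborel (exponential_density a)"
    by (rule prob_space_exponential_density[OF assms])
  have "(\<integral>\<^sup>+u. ennreal (exponential_density a u) \<partial>lborel) = 1"
    using emeasure_space_1 by (simp add: emeasure_density)
  then have i: "integrable lborel (exponential_density a)"
    using exponential_density_nonneg[OF assms] by (intro integrableI_nonneg) auto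
  have i': "integrable lborel (\<lambda>u. exponential_density a (0 + (-1) * u))"
    by (rule lborel_integrable_real_affine[OF i]) simp
  have "integrable lborel (\<lambda>u. (1/a) * (exponential_density a u + exponential_density a (0 + (-1) * u)))"
    using i i' by (intro integrable_mult_right Bochner_Integration.integrable_add)
  then show ?thesis
    by (rule Bochner_Integration.integrable_bound)
       (use assms in \<open>auto simp: exponential_density_def mult_ac intro!: AE_I2\<close>)
qed

lemma integrable_square_exp_abs: "integrable lborel (\<lambda>u::real. (1 + u\<^sup>2) * exp (- \<bar>u\<bar> / 16))"
proof (rule Bochner_Integration.integrable_bound[OF integrable_mult_right[OF integrable_exp_abs[of "1/32"], of 2048]])
  show "AE u in (lborel :: real measure). norm ((1 + u\<^sup>2) * exp (- \<bar>u\<bar> / 16)) \<le> norm (2048 * exp (- (1/32) * \<bar>u\<bar>))"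
  proof (rule AE_I2)
    fix u :: real
    \<comment> \<open>\<open>2048 = 2 * 32\<^sup>2\<close> comes from the quadratic Taylor term at
      \<open>|u| / 32\<close>: half of the decay rate 1/16 is spent on the polynomial.\<close>
    have "1 + u\<^sup>2 \<le> 2048 * exp (\<bar>u\<bar> / 32)"
      using exp_lower_Taylor_quadratic[of "\<bar>u\<bar> / 32"] by (simp add: power_divide)
    then have "(1 + u\<^sup>2) * exp (- \<bar>u\<bar> / 16) \<le> 2048 * exp (\<bar>u\<bar> / 32) * exp (- \<bar>u\<bar> / 16)"
      by (intro mult_right_mono) auto
    also have "\<dots> = 2048 * exp (- (1/32) * \<bar>u\<bar>)" unfolding mult.assoc exp_add[symmetric] by simp
    finally show "norm ((1 + u\<^sup>2) * exp (- \<bar>u\<bar> / 16)) \<le> norm (2048 * exp (- (1/32) * \<bar>u\<bar>))" by simp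
  qed
qed auto

text \<open>For \<open>h = 1\<close> this is the parallelogram law. For smaller \<open>h\<close>,
  concavity of the power bounds the left side by twice the power of \<open>c\<close>, the average of
  the two squares, and subadditivity splits the power of
  \<open>c = u\<^sup>2 + v\<^sup>2\<close>.\<close>

lemma powr_parallelogram_le:
  fixes u v :: real
  assumes "0 \<le> h" "h \<le> 1"
  shows "(\<bar>u - v\<bar> powr (2 * h)) + (\<bar>u + v\<bar> powr (2 * h)) \<le> 2 * (\<bar>u\<bar> powr (2 * h)) + 2 * (\<bar>v\<bar> powr (2 * h))"
proof -
  have sq: "\<bar>t\<bar> powr (2 * h) = (t\<^sup>2) powr h" for t :: real
    by (cases "t = 0") (simp_all add: powr_powr[symmetric])
  define c where "c = u\<^sup>2 + v\<^sup>2"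
  show ?thesis
  proof (cases "c = 0")
    case True
    then have "u = 0" "v = 0" by (auto simp: c_def sum_power2_eq_zero_iff)
    then show ?thesis by simp
  next
    case False
    moreover have "0 \<le> c" by (simp add: c_def)
    ultimately have c: "0 < c" by simp
    \<comment> \<open>Young's inequality: the tangent bound for \<open>x powr h\<close> at
      \<open>c\<close>, multiplied by \<open>c powr (1 - h)\<close>.\<close>
    have Y: "x powr h * c powr (1 - h) \<le> h * x + (1 - h) * c" if "0 \<le> x" for x
    proof (cases "x = 0")
      case True then show ?thesis using c assms by simp
    next
      case False then show ?thesis using that c assms by (intro Youngs_inequality_0) auto
    qed
    have "((u - v)\<^sup>2 powr h + (u + v)\<^sup>2 powr h) * c powr (1 - h)
        \<le> (h * (u - v)\<^sup>2 + (1 - h) * c) + (h * (u + v)\<^sup>2 + (1 - h) * c)"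
      unfolding distrib_right by (intro add_mono Y) auto
    also have "\<dots> = 2 * c" by (simp add: c_def power2_eq_square algebra_simps)
    also have "\<dots> = (2 * c powr h) * c powr (1 - h)" using c by (simp flip: powr_add)
    finally have 1: "(u - v)\<^sup>2 powr h + (u + v)\<^sup>2 powr h \<le> 2 * c powr h" using c by simp
    \<comment> \<open>Subadditivity in normalised form: a number in \<open>[0, 1]\<close> does not
      decrease when raised to a power \<open>h \<le> 1\<close>.\<close>
    have Z: "x / c \<le> x powr h / c powr h" if "0 \<le> x" "x \<le> c" for x
    proof -
      have "(x / c) powr 1 \<le> (x / c) powr h" using that c assms by (intro powr_mono') auto
      then show ?thesis using that c by (simp add: powr_divide)
    qed
    have "1 = u\<^sup>2 / c + v\<^sup>2 / c" using c unfolding add_divide_distrib[symmetric] c_def[symmetric] by simp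
    also have "\<dots> \<le> u\<^sup>2 powr h / c powr h + v\<^sup>2 powr h / c powr h"
      by (intro add_mono Z) (auto simp: c_def)
    finally have "c powr h \<le> u\<^sup>2 powr h + v\<^sup>2 powr h" using c by (simp add: field_simps)
    then show ?thesis using 1 unfolding sq by linarith
  qed
qed

section \<open>Expectation of the dominating function\<close>

context fbm
begin

lemma path_measurable: "(\<lambda>\<omega> u. L u \<omega>) \<in> measurable M (PiM UNIV (\<lambda>_. borel))"
  by (auto intro!: measurable_PiM_single')

lemma path_eval_L: "\<omega> \<in> space M \<Longrightarrow> path_eval u (\<lambda>t. L t \<omega>) = L u \<omega>"
  by (rule path_eval_continuous[OF L_continuous])

text \<open>Continuous paths agree with their dyadic evaluation, which is jointly measurable. Every
  exchange of expectation and integration over time relies on this.\<close>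

lemma L_measurable_joint [measurable (raw)]:
  assumes f: "f \<in> borel_measurable N" and g: "g \<in> measurable N M"
  shows "(\<lambda>x. L (f x) (g x)) \<in> borel_measurable N"
proof -
  have "(\<lambda>x. path_eval (f x) (\<lambda>t. L t (g x))) \<in> borel_measurable N"
    by (intro path_eval_measurable' f measurable_compose[OF g path_measurable])
  then show ?thesis
    by (rule measurable_cong[THEN iffD1, rotated]) (rule path_eval_L, rule measurable_space[OF g])
qed

lemma pw_parallelogram: "pw (u - v) + pw (u + v) \<le> 2 * pw u + 2 * pw v"
  unfolding pw_def using H_ge H_le by (intro powr_parallelogram_le) auto

text \<open>Here \<open>1/2 \<le> H\<close> gives at least linear growth, so that the Gaussian decay
  can beat an exponential tilt.\<close>

lemma pw_ge: "\<bar>t\<bar> - 1 \<le> pw t"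
proof (cases "1 \<le> \<bar>t\<bar>")
  case True
  have "\<bar>t\<bar> powr 1 \<le> \<bar>t\<bar> powr (2 * H)" using True H_ge by (intro powr_mono) auto
  then show ?thesis using True by (simp add: pw_def)
next
  case False then show ?thesis using pw_nonneg[of t] by linarith
qed

lemma pw_le_1: "\<bar>t\<bar> \<le> 1 \<Longrightarrow> pw t \<le> 1"
  unfolding pw_def using H_ge by (intro powr_le1) auto

lemma exp_minus_L:
  "integrable M (\<lambda>\<omega>. exp (- L t \<omega>))" "expectation (\<lambda>\<omega>. exp (- L t \<omega>)) = exp (pw t)"
proof -
  have *: "exp (- L t \<omega>) = exp (pw t / 2) * exp (\<Sum>j\<in>{()}. (-1) * W t \<omega>)" for \<omega>
    by (simp add: L_def flip: exp_add)
  show "integrable M (\<lambda>\<omega>. exp (- L t \<omega>))" unfolding *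
    by (intro integrable_mult_right exp_W_sum(1)) simp
  show "expectation (\<lambda>\<omega>. exp (- L t \<omega>)) = exp (pw t)" unfolding *
    by (subst integral_mult_right_zero, subst exp_W_sum(2)) (simp_all flip: exp_add)
qed

text \<open>The coefficients 1, -1/2, -1/2 sum to 0, so half the variance depends on time
  differences only: \<open>pw (u - v) / 4 + pw v / 4 - pw u / 8\<close>. Adding \<open>d\<close> and
  applying \<open>pw_parallelogram\<close> leaves at most \<open>pw v - pw u / 8\<close>; then
  \<open>pw v \<le> 1\<close> and \<open>|u| - 1 \<le> pw u\<close> give the constant 9/8.\<close>

lemma exp_L_window:
  assumes v: "\<bar>v\<bar> \<le> 1"
  shows "(\<integral>\<^sup>+\<omega>. ennreal (exp (L u \<omega> - L v \<omega> / 2 - L (u + v) \<omega> / 2)) \<partial>M) \<le> ennreal (exp (9/8 - \<bar>u\<bar> / 8))"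
proof -
  define c where "c i = [1, -1/2, -1/2 :: real] ! i" for i
  define t where "t i = [u, v, u + v] ! i" for i
  define d where "d = - pw u / 2 + pw v / 4 + pw (u + v) / 4"
  have S: "(\<Sum>i<3. f i) = f 0 + f 1 + f (2::nat)" for f :: "nat \<Rightarrow> real"
    by (simp add: eval_nat_numeral)
  have *: "exp (L u \<omega> - L v \<omega> / 2 - L (u + v) \<omega> / 2) = exp d * exp (\<Sum>i<3. c i * W (t i) \<omega>)" for \<omega>
    unfolding S by (simp add: c_def t_def L_def d_def field_simps flip: exp_add)
  have E: "(\<Sum>i<3. \<Sum>j<3. c i * c j * ((pw (t i) + pw (t j) - pw (t i - t j)) / 2)) / 2
      = pw (u - v) / 4 + pw v / 4 - pw u / 8"
    unfolding S by (simp add: c_def t_def pw_minus_commute[of v u] pw_minus_commute[of v "u + v"] field_simps)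
  have "(\<integral>\<^sup>+\<omega>. ennreal (exp (L u \<omega> - L v \<omega> / 2 - L (u + v) \<omega> / 2)) \<partial>M)
      = ennreal (expectation (\<lambda>\<omega>. exp d * exp (\<Sum>i<3. c i * W (t i) \<omega>)))"
    unfolding * by (intro nn_integral_eq_integral integrable_mult_right exp_W_sum(1)) auto
  also have "expectation (\<lambda>\<omega>. exp d * exp (\<Sum>i<3. c i * W (t i) \<omega>)) = exp d * exp (pw (u - v) / 4 + pw v / 4 - pw u / 8)"
    unfolding integral_mult_right_zero by (subst exp_W_sum(2)) (simp_all only: E finite_lessThan)
  also have "\<dots> \<le> exp (9/8 - \<bar>u\<bar> / 8)"
    unfolding exp_add[symmetric] d_def using pw_parallelogram[of u v] pw_le_1[OF v] pw_ge[of u] by simp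
  finally show ?thesis by (simp add: ennreal_leI)
qed

lemma indicator_unit_interval_measurable [measurable (raw)]:
  assumes [measurable]: "f \<in> borel_measurable N" "g \<in> borel_measurable N"
  shows "(\<lambda>x. indicator (unit_interval_towards_0 (f x)) (g x) :: real) \<in> borel_measurable N"
proof -
  have *: "(indicator (unit_interval_towards_0 u) v :: real) = (if 0 \<le> u then indicator {-1..0} v else indicator {0..1} v)" for u v
    by (simp add: unit_interval_towards_0_def)
  show ?thesis unfolding * by measurable
qed

lemma tail_kernel_measurable [measurable (raw)]:
  assumes [measurable]: "f \<in> borel_measurable N" "g \<in> measurable N M"
  shows "(\<lambda>x. tail_kernel (\<lambda>t. L t (g x)) (f x)) \<in> borel_measurable N"
  unfolding tail_kernel_def set_lebesgue_integral_def by measurable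

lemma L_shift_continuous: "\<omega> \<in> space M \<Longrightarrow> continuous_on UNIV (\<lambda>v. L (u + v) \<omega>)"
  by (rule continuous_on_compose2[OF L_continuous[of _ UNIV]]) (auto intro!: continuous_intros)

lemma tail_kernel_expectation:
  "(\<integral>\<^sup>+\<omega>. ennreal (tail_kernel (\<lambda>t. L t \<omega>) u) \<partial>M) \<le> ennreal (exp (9/8 - \<bar>u\<bar> / 8))"
proof -
  interpret P: pair_sigma_finite M lborel ..
  let ?I = "unit_interval_towards_0 u"
  have [measurable]: "?I \<in> sets borel" by (simp add: unit_interval_towards_0_def)
  have "(\<integral>\<^sup>+\<omega>. ennreal (tail_kernel (\<lambda>t. L t \<omega>) u) \<partial>M)
      = (\<integral>\<^sup>+\<omega>. (\<integral>\<^sup>+v. ennreal (indicator ?I v * exp (L u \<omega> - L v \<omega> / 2 - L (u + v) \<omega> / 2)) \<partial>lborel) \<partial>M)"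
  proof (rule nn_integral_cong)
    fix \<omega> assume \<omega>: "\<omega> \<in> space M"
    have "set_integrable lborel ?I (\<lambda>v. exp (L u \<omega> - L v \<omega> / 2 - L (u + v) \<omega> / 2))"
      by (intro set_integrable_unit_interval continuous_intros L_continuous \<omega> L_shift_continuous)  auto
    then show "ennreal (tail_kernel (\<lambda>t. L t \<omega>) u) = (\<integral>\<^sup>+v. ennreal (indicator ?I v * exp (L u \<omega> - L v \<omega> / 2 - L (u + v) \<omega> / 2)) \<partial>lborel)"
      unfolding tail_kernel_def set_lebesgue_integral_def
      by (subst nn_integral_eq_integral) (auto simp: set_integrable_def)
  qed
  also have "\<dots> = (\<integral>\<^sup>+v. (\<integral>\<^sup>+\<omega>. ennreal (indicator ?I v * exp (L u \<omega> - L v \<omega> / 2 - L (u + v) \<omega> / 2)) \<partial>M) \<partial>lborel)"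
    by (rule P.Fubini'[symmetric]) measurable
  also have "\<dots> \<le> (\<integral>\<^sup>+v. ennreal (exp (9/8 - \<bar>u\<bar> / 8)) * indicator ?I v \<partial>lborel)"
  proof (rule nn_integral_mono)
    fix v
    show "(\<integral>\<^sup>+\<omega>. ennreal (indicator ?I v * exp (L u \<omega> - L v \<omega> / 2 - L (u + v) \<omega> / 2)) \<partial>M) \<le> ennreal (exp (9/8 - \<bar>u\<bar> / 8)) * indicator ?I v"
    proof (cases "v \<in> ?I")
      case True
      then have "\<bar>v\<bar> \<le> 1" by (auto simp: unit_interval_towards_0_def split: if_splits)
      then show ?thesis using True exp_L_window[of v u] by simp
    qed simp
  qed
  also have "\<dots> = ennreal (exp (9/8 - \<bar>u\<bar> / 8))"
    by (subst nn_integral_cmult) (auto simp: unit_interval_towards_0_def)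
  finally show ?thesis .
qed

text \<open>Tonelli makes the joint function integrable from a bound on the expectation at each
  \<open>u\<close>; Fubini then yields both conclusions.\<close>

lemma integrable_swap:
  fixes f :: "real \<Rightarrow> 'a \<Rightarrow> real"
  assumes m[measurable]: "(\<lambda>p. f (snd p) (fst p)) \<in> borel_measurable (M \<Otimes>\<^sub>M lborel)"
    and f: "\<And>u \<omega>. 0 \<le> f u \<omega>" and b: "\<And>u. (\<integral>\<^sup>+\<omega>. ennreal (f u \<omega>) \<partial>M) \<le> ennreal (h u)"
    and h: "integrable lborel h" "\<And>u. 0 \<le> h u"
  shows "AE \<omega> in M. integrable lborel (\<lambda>u. f u \<omega>)" and "integrable M (\<lambda>\<omega>. \<integral>u. f u \<omega> \<partial>lborel)"
proof -
  interpret P: pair_sigma_finite M lborel ..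
  have "(\<integral>\<^sup>+p. ennreal (f (snd p) (fst p)) \<partial>(M \<Otimes>\<^sub>M lborel)) = (\<integral>\<^sup>+u. (\<integral>\<^sup>+\<omega>. ennreal (f u \<omega>) \<partial>M) \<partial>lborel)"
    by (subst P.nn_integral_snd[symmetric]) auto
  also have "\<dots> \<le> (\<integral>\<^sup>+u. ennreal (h u) \<partial>lborel)" by (rule nn_integral_mono) (rule b)
  also have "\<dots> < \<infinity>" using h by (simp add: nn_integral_eq_integral)
  finally have i: "integrable (M \<Otimes>\<^sub>M lborel) (\<lambda>p. f (snd p) (fst p))"
    using f by (intro integrableI_nonneg) auto
  show "AE \<omega> in M. integrable lborel (\<lambda>u. f u \<omega>)" and "integrable M (\<lambda>\<omega>. \<integral>u. f u \<omega> \<partial>lborel)"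
    using P.AE_integrable_fst'[OF i] P.integrable_fst'[OF i] by simp_all
qed

definition G :: "'a \<Rightarrow> real \<Rightarrow> real" where
  "G \<omega> u = exp (1/8 + \<bar>u\<bar> / 16) * tail_kernel (\<lambda>t. L t \<omega>) u"

lemma G_integrable:
  shows "AE \<omega> in M. integrable lborel (\<lambda>u. (1 + u\<^sup>2) * G \<omega> u)"
    and "integrable M (\<lambda>\<omega>. \<integral>u. (1 + u\<^sup>2) * G \<omega> u \<partial>lborel)"
proof -
  have b: "(\<integral>\<^sup>+\<omega>. ennreal ((1 + u\<^sup>2) * G \<omega> u) \<partial>M) \<le> ennreal (exp (10/8) * ((1 + u\<^sup>2) * exp (- \<bar>u\<bar> / 16)))" for u
  proof -
    have "(\<integral>\<^sup>+\<omega>. ennreal ((1 + u\<^sup>2) * G \<omega> u) \<partial>M)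
       = (\<integral>\<^sup>+\<omega>. ennreal ((1 + u\<^sup>2) * exp (1/8 + \<bar>u\<bar> / 16)) * ennreal (tail_kernel (\<lambda>t. L t \<omega>) u) \<partial>M)"
      by (intro nn_integral_cong) (simp add: G_def ennreal_mult[symmetric] tail_kernel_nonneg mult.assoc)
    also have "\<dots> = ennreal ((1 + u\<^sup>2) * exp (1/8 + \<bar>u\<bar> / 16)) * (\<integral>\<^sup>+\<omega>. ennreal (tail_kernel (\<lambda>t. L t \<omega>) u) \<partial>M)"
      by (rule nn_integral_cmult) measurable
    also have "\<dots> \<le> ennreal ((1 + u\<^sup>2) * exp (1/8 + \<bar>u\<bar> / 16)) * ennreal (exp (9/8 - \<bar>u\<bar> / 8))"
      by (intro mult_left_mono tail_kernel_expectation) auto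
    also have "\<dots> = ennreal ((1 + u\<^sup>2) * (exp (1/8 + \<bar>u\<bar> / 16) * exp (9/8 - \<bar>u\<bar> / 8)))"
      by (simp add: ennreal_mult[symmetric] mult.assoc)
    \<comment> \<open>The tilt costs \<open>|u| / 16\<close> and the Gaussian moment gains
      \<open>|u| / 8\<close>; the rate 1/16 that remains controls the weight
      \<open>1 + u\<^sup>2\<close>.\<close>
    also have "exp (1/8 + \<bar>u\<bar> / 16) * exp (9/8 - \<bar>u\<bar> / 8) = exp (10/8) * exp (- \<bar>u\<bar> / 16)"
      by (simp flip: exp_add)
    finally show ?thesis by (simp only: mult_ac)
  qed
  have m: "(\<lambda>p. (1 + (snd p)\<^sup>2) * G (fst p) (snd p)) \<in> borel_measurable (M \<Otimes>\<^sub>M lborel)"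
    unfolding G_def by measurable
  have n: "0 \<le> (1 + u\<^sup>2) * G \<omega> u" for u \<omega> by (simp add: G_def tail_kernel_nonneg)
  have h: "integrable lborel (\<lambda>u. exp (10/8) * ((1 + u\<^sup>2) * exp (- \<bar>u\<bar> / 16)) :: real)"
    by (intro integrable_mult_right integrable_square_exp_abs)
  show "AE \<omega> in M. integrable lborel (\<lambda>u. (1 + u\<^sup>2) * G \<omega> u)"
    by (rule integrable_swap(1)[OF m n b h]) simp
  show "integrable M (\<lambda>\<omega>. \<integral>u. (1 + u\<^sup>2) * G \<omega> u \<partial>lborel)"
    by (rule integrable_swap(2)[OF m n b h]) simp
qed

text \<open>Since \<open>exp (L u)\<close> has expectation 1 at every \<open>u\<close>, its integral
  over the line has infinite expectation. The damping restores integrability, and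
  \<open>ln_A_0_bound\<close> pays for it.\<close>

lemma damped_integrable:
  shows "AE \<omega> in M. integrable lborel (\<lambda>u. exp (L u \<omega> - \<bar>u\<bar>))"
    and "integrable M (\<lambda>\<omega>. \<integral>u. exp (L u \<omega> - \<bar>u\<bar>) \<partial>lborel)"
proof -
  have b: "(\<integral>\<^sup>+\<omega>. ennreal (exp (L u \<omega> - \<bar>u\<bar>)) \<partial>M) \<le> ennreal (exp (- 1 * \<bar>u\<bar>))" for u
  proof -
    have *: "exp (L u \<omega> - \<bar>u\<bar>) = exp (- \<bar>u\<bar>) * exp (L u \<omega>)" for \<omega> by (simp flip: exp_add)
    show ?thesis unfolding * using exp_L_1[of u] by (subst nn_integral_eq_integral) auto
  qed
  have m: "(\<lambda>p. exp (L (snd p) (fst p) - \<bar>snd p\<bar>)) \<in> borel_measurable (M \<Otimes>\<^sub>M lborel)"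
    by measurable
  have h: "integrable lborel (\<lambda>u. exp (- 1 * \<bar>u\<bar>) :: real)"
    by (rule integrable_exp_abs) simp
  show "AE \<omega> in M. integrable lborel (\<lambda>u. exp (L u \<omega> - \<bar>u\<bar>))"
    by (rule integrable_swap(1)[OF m _ b h]) auto
  show "integrable M (\<lambda>\<omega>. \<integral>u. exp (L u \<omega> - \<bar>u\<bar>) \<partial>lborel)"
    by (rule integrable_swap(2)[OF m _ b h]) auto
qed

lemma inverse_integrable: "integrable M (\<lambda>\<omega>. LINT v:{0..1}|lborel. exp (- L v \<omega>))"
proof -
  have b: "(\<integral>\<^sup>+\<omega>. ennreal (indicator {0..1} v *\<^sub>R exp (- L v \<omega>)) \<partial>M) \<le> ennreal (indicator {0..1} v *\<^sub>R exp 1)" for v :: real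
    using exp_minus_L[of v] pw_le_1[of v] by (auto simp: indicator_def nn_integral_eq_integral ennreal_leI)
  have m: "(\<lambda>p. indicator {0..1} (snd p) *\<^sub>R exp (- L (snd p) (fst p))) \<in> borel_measurable (M \<Otimes>\<^sub>M lborel)"
    by measurable
  show ?thesis unfolding set_lebesgue_integral_def
    by (rule integrable_swap(2)[where h="\<lambda>v. indicator {0..1} v *\<^sub>R exp 1", OF m _ b]) auto
qed

lemma AE_dominated_tilt: "AE \<omega> in M. dominated_tilt (\<lambda>t. L t \<omega>) (G \<omega>)"
  using G_integrable(1) AE_space
proof eventually_elim
  case (elim \<omega>)
  have l: "continuous_on UNIV (\<lambda>t. L t \<omega>)" by (rule L_continuous[OF elim(2)])
  show ?case
  proof
    fix m N u :: real assume a: "\<bar>m\<bar> \<le> 1/8" "1 \<le> N" "\<bar>u\<bar> \<le> N"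
    have "exp (L u \<omega> + m * u) \<le> tail_kernel (\<lambda>u. L u \<omega> + m * u) u * (LINT v:{-N..N}|lborel. exp (L v \<omega> + m * v))"
      by (rule exp_le_tail_kernel[OF _ a(2,3), of "\<lambda>u. L u \<omega> + m * u"]) (intro continuous_intros l)
    also have "\<dots> \<le> G \<omega> u * (LINT v:{-N..N}|lborel. exp (L v \<omega> + m * v))"
      unfolding G_def
      by (intro mult_right_mono tail_kernel_tilt l a) (auto simp: set_lebesgue_integral_def intro!: integral_nonneg_AE)
    finally show "exp (L u \<omega> + m * u) \<le> G \<omega> u * (LINT v:{-N..N}|lborel. exp (L v \<omega> + m * v))" .
  qed (use l elim in \<open>auto simp: G_def tail_kernel_nonneg\<close>)
qed

end

section \<open>The variance identity\<close>

context fbm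
begin

text \<open>The moments \<open>A\<close> of a path, written as functions of the sample point so that
  measurability is visible. The facts of \<open>dominated_tilt\<close> hold for them almost surely,
  through \<open>tilt_abbrevs\<close>.\<close>

definition mom :: "nat \<Rightarrow> 'a \<Rightarrow> real \<Rightarrow> real" where
  "mom k \<omega> m = (\<integral>u. u ^ k * exp (L u \<omega> + m * u) \<partial>lborel)"

definition bd :: "'a \<Rightarrow> real" where "bd \<omega> = (\<integral>u. (1 + u\<^sup>2) * G \<omega> u \<partial>lborel)"

definition V :: "'a \<Rightarrow> real \<Rightarrow> real" where
  "V \<omega> m = mom 2 \<omega> m / mom 0 \<omega> m - (mom 1 \<omega> m / mom 0 \<omega> m)\<^sup>2"

definition zeta :: "'a \<Rightarrow> real" where "zeta \<omega> = mom 1 \<omega> 0 / mom 0 \<omega> 0"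

lemma mom_measurable [measurable]: "(\<lambda>\<omega>. mom k \<omega> m) \<in> borel_measurable M"
  unfolding mom_def by measurable

lemma V_measurable [measurable]: "(\<lambda>\<omega>. V \<omega> m) \<in> borel_measurable M"
  unfolding V_def by measurable

lemma zeta_measurable [measurable]: "zeta \<in> borel_measurable M"
  unfolding zeta_def[abs_def] by measurable

lemma fBm_Z_exp: "fBm_Z H W u \<omega> * exp (m * u) = exp (L u \<omega> + m * u)"
  by (simp add: fBm_Z_def L_def pw_def exp_add)

lemma fBm_Z_L: "fBm_Z H W u \<omega> = exp (L u \<omega>)"
  by (simp add: fBm_Z_def L_def pw_def)

lemma integral_fBm_Z: "(\<integral>u. fBm_Z H W u \<omega> * exp (m * u) \<partial>lborel) = mom 0 \<omega> m"
  by (simp add: fBm_Z_exp mom_def)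

lemma fBm_zeta_eq: "fBm_zeta H W = zeta"
  by (simp add: fun_eq_iff fBm_zeta_def fBm_q_def fBm_Z_L zeta_def mom_def)

lemma fBm_g_eq: "fBm_g M H W = (\<lambda>m. expectation (\<lambda>\<omega>. ln (mom 0 \<omega> m)))"
  by (simp add: fBm_g_def integral_fBm_Z fun_eq_iff)

lemma bd_integrable: "integrable M bd"
  unfolding bd_def[abs_def] by (rule G_integrable(2))

lemma bd_nonneg: "0 \<le> bd \<omega>"
  unfolding bd_def by (intro integral_nonneg_AE) (auto simp: G_def tail_kernel_nonneg)

lemma tilt_abbrevs:
  assumes "dominated_tilt (\<lambda>t. L t \<omega>) (G \<omega>)"
  shows "dominated_tilt.A (\<lambda>t. L t \<omega>) k m = mom k \<omega> m" "dominated_tilt.K (G \<omega>) = bd \<omega>"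
    "dominated_tilt.z (\<lambda>t. L t \<omega>) m u = exp (L u \<omega> + m * u)"
proof -
  interpret dominated_tilt "\<lambda>t. L t \<omega>" "G \<omega>" by fact
  show "A k m = mom k \<omega> m" "K = bd \<omega>" "z m u = exp (L u \<omega> + m * u)"
    by (simp_all add: A_def z_def K_def mom_def bd_def)
qed

text \<open>The calculus of a single path in the form that differentiation under the expectation
  requires: one null set for all \<open>m\<close>, and the integrable majorant \<open>bd\<close>.
  The last statement gathers what the variance identity uses at \<open>m = 0\<close>.\<close>

lemma AE_derivatives:
  "AE \<omega> in M. \<forall>m\<in>{-1/8<..<1/8}. ((\<lambda>m. ln (mom 0 \<omega> m)) has_real_derivative mom 1 \<omega> m / mom 0 \<omega> m) (at m)
     \<and> \<bar>mom 1 \<omega> m / mom 0 \<omega> m\<bar> \<le> bd \<omega>"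
  "AE \<omega> in M. \<forall>m\<in>{-1/8<..<1/8}. ((\<lambda>m. mom 1 \<omega> m / mom 0 \<omega> m) has_real_derivative V \<omega> m) (at m) \<and> \<bar>V \<omega> m\<bar> \<le> bd \<omega>"
  "AE \<omega> in M. continuous_on {-1/8<..<1/8} (V \<omega>) \<and> (\<forall>m\<in>{-1/8<..<1/8}. \<bar>V \<omega> m\<bar> \<le> bd \<omega>)"
  "AE \<omega> in M. \<bar>zeta \<omega>\<bar> \<le> bd \<omega> \<and> 0 \<le> V \<omega> 0 \<and> 0 < mom 0 \<omega> 0 \<and> integrable lborel (\<lambda>u. exp (L u \<omega>))
      \<and> integrable lborel (\<lambda>u. u * exp (L u \<omega>))
      \<and> (\<forall>c. integrable lborel (\<lambda>u. (c - u)\<^sup>2 * (exp (L u \<omega>) / mom 0 \<omega> 0))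
        \<and> (\<integral>u. (c - u)\<^sup>2 * (exp (L u \<omega>) / mom 0 \<omega> 0) \<partial>lborel) = V \<omega> 0 + (c - zeta \<omega>)\<^sup>2)"
proof -
  show "AE \<omega> in M. \<forall>m\<in>{-1/8<..<1/8}. ((\<lambda>m. ln (mom 0 \<omega> m)) has_real_derivative mom 1 \<omega> m / mom 0 \<omega> m) (at m)
     \<and> \<bar>mom 1 \<omega> m / mom 0 \<omega> m\<bar> \<le> bd \<omega>"
    using AE_dominated_tilt
  proof eventually_elim
    case (elim \<omega>)
    interpret T: dominated_tilt "\<lambda>t. L t \<omega>" "G \<omega>" by fact
    note [simp] = tilt_abbrevs[OF elim]
    show ?case
    proof (intro ballI conjI)
      fix m :: real assume m: "m \<in> {-1/8<..<1/8}"
      then have m': "\<bar>m\<bar> \<le> 1/8" by (auto simp: abs_le_iff)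
      show "((\<lambda>m. ln (mom 0 \<omega> m)) has_real_derivative mom 1 \<omega> m / mom 0 \<omega> m) (at m)"
        using T.ln_A_derivative(1)[OF m] by simp
      show "\<bar>mom 1 \<omega> m / mom 0 \<omega> m\<bar> \<le> bd \<omega>"
        using T.A_quotient_le[OF m', of 1] by simp
    qed
  qed
  show "AE \<omega> in M. \<forall>m\<in>{-1/8<..<1/8}. ((\<lambda>m. mom 1 \<omega> m / mom 0 \<omega> m) has_real_derivative V \<omega> m) (at m) \<and> \<bar>V \<omega> m\<bar> \<le> bd \<omega>"
    using AE_dominated_tilt
  proof eventually_elim
    case (elim \<omega>)
    interpret T: dominated_tilt "\<lambda>t. L t \<omega>" "G \<omega>" by fact
    note [simp] = tilt_abbrevs[OF elim]
    show ?case
    proof (intro ballI conjI)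
      fix m :: real assume m: "m \<in> {-1/8<..<1/8}"
      then have m': "\<bar>m\<bar> \<le> 1/8" by (auto simp: abs_le_iff)
      show "((\<lambda>m. mom 1 \<omega> m / mom 0 \<omega> m) has_real_derivative V \<omega> m) (at m)"
        using T.ln_A_derivative(2)[OF m] by (simp add: V_def)
      show "\<bar>V \<omega> m\<bar> \<le> bd \<omega>"
        using T.variance_bounds(1,2)[OF m'] by (simp add: V_def)
    qed
  qed
  show "AE \<omega> in M. continuous_on {-1/8<..<1/8} (V \<omega>) \<and> (\<forall>m\<in>{-1/8<..<1/8}. \<bar>V \<omega> m\<bar> \<le> bd \<omega>)"
    using AE_dominated_tilt
  proof eventually_elim
    case (elim \<omega>)
    interpret T: dominated_tilt "\<lambda>t. L t \<omega>" "G \<omega>" by fact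
    note e = tilt_abbrevs[OF elim]
    have c: "continuous_on {-1/8<..<1/8} (\<lambda>m. mom k \<omega> m)" if "k \<le> 2" for k
      using T.A_continuous[OF that] unfolding e .
    have p: "mom 0 \<omega> m \<noteq> 0" if "m \<in> {-1/8<..<1/8}" for m
    proof -
      have "\<bar>m\<bar> \<le> 1/8" using that by (auto simp: abs_le_iff)
      from T.A_pos[OF this] show ?thesis by (simp add: e)
    qed
    show ?case
    proof (intro ballI conjI)
      show "continuous_on {-1/8<..<1/8} (V \<omega>)"
        unfolding V_def[abs_def] using p by (intro continuous_intros c) auto
      fix m :: real assume m: "m \<in> {-1/8<..<1/8}"
      then have m': "\<bar>m\<bar> \<le> 1/8" by (auto simp: abs_le_iff)
      show "\<bar>V \<omega> m\<bar> \<le> bd \<omega>"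
        using T.variance_bounds(1,2)[OF m'] by (simp add: V_def e)
    qed
  qed
  show "AE \<omega> in M. \<bar>zeta \<omega>\<bar> \<le> bd \<omega> \<and> 0 \<le> V \<omega> 0 \<and> 0 < mom 0 \<omega> 0 \<and> integrable lborel (\<lambda>u. exp (L u \<omega>))
      \<and> integrable lborel (\<lambda>u. u * exp (L u \<omega>))
      \<and> (\<forall>c. integrable lborel (\<lambda>u. (c - u)\<^sup>2 * (exp (L u \<omega>) / mom 0 \<omega> 0))
        \<and> (\<integral>u. (c - u)\<^sup>2 * (exp (L u \<omega>) / mom 0 \<omega> 0) \<partial>lborel) = V \<omega> 0 + (c - zeta \<omega>)\<^sup>2)"
    using AE_dominated_tilt
  proof eventually_elim
    case (elim \<omega>)
    interpret T: dominated_tilt "\<lambda>t. L t \<omega>" "G \<omega>" by fact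
    note e = tilt_abbrevs[OF elim]
    show ?case
      using T.A_quotient_le[of 0 1] T.variance_bounds(1)[of 0] T.A_pos[of 0] T.moment_integrable[of 0 0] T.moment_integrable[of 0 1]
         T.centered_second_moment[of 0]
      by (simp add: e V_def zeta_def)
  qed
qed

text \<open>Only \<open>m = 0\<close> is estimated directly. The logarithm at another
  \<open>m\<close> differs from it by at most \<open>bd\<close>, by the mean value inequality, which
  turns \<open>2 * bd\<close> into \<open>3 * bd\<close>.\<close>

lemma ln_mom_integrable:
  assumes m: "m \<in> {-1/8<..<1/8}" shows "integrable M (\<lambda>\<omega>. ln (mom 0 \<omega> m))"
proof -
  let ?h = "\<lambda>\<omega>. 2 + 3 * bd \<omega> + (\<integral>u. exp (L u \<omega> - \<bar>u\<bar>) \<partial>lborel) + (LINT v:{0..1}|lborel. exp (- L v \<omega>))"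
  have h: "integrable M ?h"
    using bd_integrable damped_integrable(2) inverse_integrable by auto
  have "AE \<omega> in M. \<bar>ln (mom 0 \<omega> 0)\<bar> \<le> 2 + 2 * bd \<omega> + (\<integral>u. exp (L u \<omega> - \<bar>u\<bar>) \<partial>lborel) + (LINT v:{0..1}|lborel. exp (- L v \<omega>))"
    using AE_dominated_tilt damped_integrable(1)
  proof eventually_elim
    case (elim \<omega>)
    then show ?case using dominated_tilt.ln_A_0_bound[OF elim] by (simp add: tilt_abbrevs)
  qed
  then have b: "AE \<omega> in M. norm (ln (mom 0 \<omega> m)) \<le> norm (?h \<omega>)"
    using AE_derivatives(1)
  proof eventually_elim
    case (elim \<omega>)
    have "norm (ln (mom 0 \<omega> m) - ln (mom 0 \<omega> 0)) \<le> bd \<omega> * norm (m - 0)"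
      by (rule field_differentiable_bound[where S="{-1/8<..<1/8}" and f'="\<lambda>m. mom 1 \<omega> m / mom 0 \<omega> m"])
         (use elim m in \<open>auto intro: has_field_derivative_at_within\<close>)
    also have "\<dots> \<le> bd \<omega> * 1"
      by (rule mult_left_mono) (use m bd_nonneg in auto)
    finally show ?case using elim(1) abs_ge_self[of "?h \<omega>"] unfolding real_norm_def by linarith
  qed
  show ?thesis by (rule Bochner_Integration.integrable_bound[OF h _ b]) measurable
qed

lemma tilted_mean_integrable:
  assumes m: "m \<in> {-1/8<..<1/8}" shows "integrable M (\<lambda>\<omega>. mom 1 \<omega> m / mom 0 \<omega> m)"
proof (rule Bochner_Integration.integrable_bound[OF bd_integrable])
  show "AE \<omega> in M. norm (mom 1 \<omega> m / mom 0 \<omega> m) \<le> norm (bd \<omega>)"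
    using AE_derivatives(1)
  proof eventually_elim
    case (elim \<omega>)
    then show ?case using m bd_nonneg[of \<omega>] by (simp only: real_norm_def abs_of_nonneg)
  qed
qed measurable

section \<open>Change of measure on path functionals and the variance of the mean\<close>

definition path_mass :: "(real \<Rightarrow> real) \<Rightarrow> real" where
  "path_mass x = (\<integral>u. exp (path_eval u x) \<partial>lborel)"

text \<open>\<open>path_eval\<close> makes mass and mean measurable on the product space, so that
  \<open>shift_law\<close> applies to them; on continuous paths they are the usual ones.\<close>

definition path_mean :: "(real \<Rightarrow> real) \<Rightarrow> real" where
  "path_mean x = (\<integral>u. u * exp (path_eval u x) \<partial>lborel) / path_mass x"

lemma path_functional_measurable [measurable]:
  "path_mass \<in> borel_measurable (PiM UNIV (\<lambda>_. borel))"
  "path_mean \<in> borel_measurable (PiM UNIV (\<lambda>_. borel))"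
  unfolding path_mass_def[abs_def] path_mean_def[abs_def] by measurable

lemma shifted_path_measurable [measurable]:
  "(\<lambda>\<omega> u. L (u - t) \<omega> - L (- t) \<omega>) \<in> measurable M (PiM UNIV (\<lambda>_. borel))"
  by (auto intro!: measurable_PiM_single')

lemma nn_integral_shift:
  assumes F[measurable]: "F \<in> borel_measurable (PiM UNIV (\<lambda>_. borel))"
  shows "(\<integral>\<^sup>+\<omega>. ennreal (exp (L t \<omega>)) * F (\<lambda>u. L u \<omega>) \<partial>M) = (\<integral>\<^sup>+\<omega>. F (\<lambda>u. L (u - t) \<omega> - L (- t) \<omega>) \<partial>M)"
proof -
  note [measurable] = path_measurable
  have "(\<integral>\<^sup>+\<omega>. ennreal (exp (L t \<omega>)) * F (\<lambda>u. L u \<omega>) \<partial>M)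
      = (\<integral>\<^sup>+\<omega>. F (\<lambda>u. L u \<omega>) \<partial>density M (\<lambda>\<omega>. ennreal (exp (L t \<omega>))))"
    by (subst nn_integral_density) (auto intro: measurable_compose[OF path_measurable])
  also have "\<dots> = (\<integral>\<^sup>+x. F x \<partial>distr (density M (\<lambda>\<omega>. ennreal (exp (L t \<omega>)))) (PiM UNIV (\<lambda>_. borel)) (\<lambda>\<omega> u. L u \<omega>))"
    by (subst nn_integral_distr) (auto intro: path_measurable)
  also have "\<dots> = (\<integral>\<^sup>+\<omega>. F (\<lambda>u. L (u - t) \<omega> - L (- t) \<omega>) \<partial>M)"
    unfolding shift_law by (subst nn_integral_distr) auto
  finally show ?thesis .
qed

lemma path_functional_L:
  assumes "\<omega> \<in> space M"
  shows "path_mass (\<lambda>u. L u \<omega>) = mom 0 \<omega> 0" "path_mean (\<lambda>u. L u \<omega>) = zeta \<omega>"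
  using path_eval_L[OF assms] by (simp_all add: path_mass_def path_mean_def zeta_def mom_def)

text \<open>Translating the path by \<open>t\<close> translates the normalised density by
  \<open>t\<close>. The subtracted constant \<open>L (- t)\<close> cancels in the mean and survives
  in the mass.\<close>

lemma path_functional_shift:
  assumes \<omega>: "\<omega> \<in> space M" and p: "0 < mom 0 \<omega> 0"
    and i: "integrable lborel (\<lambda>u. exp (L u \<omega>))" "integrable lborel (\<lambda>u. u * exp (L u \<omega>))"
  shows "path_mass (\<lambda>u. L (u - t) \<omega> - L (- t) \<omega>) = mom 0 \<omega> 0 / exp (L (- t) \<omega>)"
    "path_mean (\<lambda>u. L (u - t) \<omega> - L (- t) \<omega>) = zeta \<omega> + t"
proof -
  have c: "continuous_on UNIV (\<lambda>u. L (u - t) \<omega> - L (- t) \<omega>)"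
    using L_shift_continuous[OF \<omega>, of "- t"] by (intro continuous_intros) simp
  have e: "exp (path_eval u (\<lambda>u. L (u - t) \<omega> - L (- t) \<omega>)) = exp (L (u - t) \<omega>) / exp (L (- t) \<omega>)" for u
    unfolding path_eval_continuous[OF c] by (simp add: exp_diff)
  have s: "(\<integral>u. f (u - t) \<partial>lborel) = (\<integral>u. f u \<partial>lborel)" for f :: "real \<Rightarrow> real"
    by (subst lborel_integral_real_affine[where c=1 and t="- t" and f=f]) simp_all
  show 1: "path_mass (\<lambda>u. L (u - t) \<omega> - L (- t) \<omega>) = mom 0 \<omega> 0 / exp (L (- t) \<omega>)"
    unfolding path_mass_def e using s[of "\<lambda>u. exp (L u \<omega>)"] by (simp add: mom_def)
  have "(\<integral>u. u * exp (path_eval u (\<lambda>u. L (u - t) \<omega> - L (- t) \<omega>)) \<partial>lborel)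
      = (\<integral>u. (u * exp (L (u - t) \<omega>)) / exp (L (- t) \<omega>) \<partial>lborel)"
    unfolding e by simp
  also have "\<dots> = (\<integral>u. u * exp (L (u - t) \<omega>) \<partial>lborel) / exp (L (- t) \<omega>)"
    by simp
  also have "(\<integral>u. u * exp (L (u - t) \<omega>) \<partial>lborel) = (\<integral>u. (u + t) * exp (L u \<omega>) \<partial>lborel)"
    using s[of "\<lambda>u. (u + t) * exp (L u \<omega>)"] by simp
  also have "\<dots> = mom 1 \<omega> 0 + t * mom 0 \<omega> 0"
    using i by (simp add: distrib_right mom_def)
  finally show "path_mean (\<lambda>u. L (u - t) \<omega> - L (- t) \<omega>) = zeta \<omega> + t"
    unfolding path_mean_def 1 using p by (simp add: zeta_def field_simps)
qed

text \<open>Letting \<open>c\<close> vary is what yields \<open>expectation zeta = 0\<close>, without a reflection argument.\<close>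

lemma zeta_second_moment_nn:
  "(\<integral>\<^sup>+\<omega>. ennreal ((zeta \<omega> - c)\<^sup>2) \<partial>M) = (\<integral>\<^sup>+\<omega>. ennreal (V \<omega> 0 + c\<^sup>2) \<partial>M)"
proof -
  interpret P: pair_sigma_finite M lborel ..
  note [measurable] = path_measurable
  \<comment> \<open>Multiplied by \<open>exp (L t)\<close>, this is the squared deviation times the
    density \<open>q 0 t\<close>, as a functional of the path.\<close>
  define F where "F x = ennreal ((path_mean x - c)\<^sup>2 / path_mass x)" for x
  have [measurable]: "F \<in> borel_measurable (PiM UNIV (\<lambda>_. borel))" unfolding F_def by measurable
  \<comment> \<open>The factor 1 is inserted as the integral of \<open>q 0\<close> over
    \<open>t\<close>. Nonnegative integrals throughout allow the exchanges before any second moment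
    is known to be finite.\<close>
  have "(\<integral>\<^sup>+\<omega>. ennreal ((zeta \<omega> - c)\<^sup>2) \<partial>M) = (\<integral>\<^sup>+\<omega>. (\<integral>\<^sup>+t. ennreal (exp (L t \<omega>) * ((zeta \<omega> - c)\<^sup>2 / mom 0 \<omega> 0)) \<partial>lborel) \<partial>M)"
  proof (rule nn_integral_cong_AE)
    show "AE \<omega> in M. ennreal ((zeta \<omega> - c)\<^sup>2) = (\<integral>\<^sup>+t. ennreal (exp (L t \<omega>) * ((zeta \<omega> - c)\<^sup>2 / mom 0 \<omega> 0)) \<partial>lborel)"
      using AE_derivatives(4)
    proof eventually_elim
      case (elim \<omega>)
      then have "(\<integral>\<^sup>+t. ennreal (exp (L t \<omega>) * ((zeta \<omega> - c)\<^sup>2 / mom 0 \<omega> 0)) \<partial>lborel)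
        = ennreal (\<integral>t. exp (L t \<omega>) * ((zeta \<omega> - c)\<^sup>2 / mom 0 \<omega> 0) \<partial>lborel)"
        by (intro nn_integral_eq_integral integrable_mult_left) auto
      also have "(\<integral>t. exp (L t \<omega>) * ((zeta \<omega> - c)\<^sup>2 / mom 0 \<omega> 0) \<partial>lborel) = mom 0 \<omega> 0 * ((zeta \<omega> - c)\<^sup>2 / mom 0 \<omega> 0)"
        unfolding integral_mult_left_zero by (simp add: mom_def)
      finally show ?case using elim by simp
    qed
  qed
  also have "\<dots> = (\<integral>\<^sup>+t. (\<integral>\<^sup>+\<omega>. ennreal (exp (L t \<omega>) * ((zeta \<omega> - c)\<^sup>2 / mom 0 \<omega> 0)) \<partial>M) \<partial>lborel)"
    by (rule P.Fubini'[symmetric]) measurable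
  also have "\<dots> = (\<integral>\<^sup>+t. (\<integral>\<^sup>+\<omega>. ennreal (exp (L t \<omega>)) * F (\<lambda>u. L u \<omega>) \<partial>M) \<partial>lborel)"
    by (intro nn_integral_cong) (simp add: F_def path_functional_L ennreal_mult'[symmetric])
  also have "\<dots> = (\<integral>\<^sup>+t. (\<integral>\<^sup>+\<omega>. F (\<lambda>u. L (u - t) \<omega> - L (- t) \<omega>) \<partial>M) \<partial>lborel)"
    by (intro nn_integral_cong nn_integral_shift) measurable
  also have "\<dots> = (\<integral>\<^sup>+t. (\<integral>\<^sup>+\<omega>. ennreal ((zeta \<omega> - c + t)\<^sup>2 * (exp (L (- t) \<omega>) / mom 0 \<omega> 0)) \<partial>M) \<partial>lborel)"
  proof (rule nn_integral_cong, rule nn_integral_cong_AE)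
    fix t
    show "AE \<omega> in M. F (\<lambda>u. L (u - t) \<omega> - L (- t) \<omega>) = ennreal ((zeta \<omega> - c + t)\<^sup>2 * (exp (L (- t) \<omega>) / mom 0 \<omega> 0))"
      using AE_derivatives(4) AE_space
    proof eventually_elim
      case (elim \<omega>)
      then have "path_mass (\<lambda>u. L (u - t) \<omega> - L (- t) \<omega>) = mom 0 \<omega> 0 / exp (L (- t) \<omega>)"
        "path_mean (\<lambda>u. L (u - t) \<omega> - L (- t) \<omega>) = zeta \<omega> + t"
        by (intro path_functional_shift; simp)+
      then show ?case unfolding F_def by (simp add: algebra_simps)
    qed
  qed
  also have "\<dots> = (\<integral>\<^sup>+\<omega>. (\<integral>\<^sup>+t. ennreal ((zeta \<omega> - c + t)\<^sup>2 * (exp (L (- t) \<omega>) / mom 0 \<omega> 0)) \<partial>lborel) \<partial>M)"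
    by (rule P.Fubini') measurable
  also have "\<dots> = (\<integral>\<^sup>+\<omega>. ennreal (V \<omega> 0 + c\<^sup>2) \<partial>M)"
  proof (rule nn_integral_cong_AE)
    show "AE \<omega> in M. (\<integral>\<^sup>+t. ennreal ((zeta \<omega> - c + t)\<^sup>2 * (exp (L (- t) \<omega>) / mom 0 \<omega> 0)) \<partial>lborel) = ennreal (V \<omega> 0 + c\<^sup>2)"
      using AE_derivatives(4) AE_space
    proof eventually_elim
      case (elim \<omega>)
      have m: "(\<lambda>u. L u \<omega>) \<in> borel_measurable borel"
        by (rule borel_measurable_continuous_onI[OF L_continuous[OF elim(2)]])
      \<comment> \<open>With \<open>s = - t\<close> this is the mean square error of the centre
        \<open>zeta - c\<close>, whose distance to the mean of \<open>q 0\<close> contributes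
        \<open>c\<^sup>2\<close>.\<close>
      have "(\<integral>\<^sup>+t. ennreal ((zeta \<omega> - c + t)\<^sup>2 * (exp (L (- t) \<omega>) / mom 0 \<omega> 0)) \<partial>lborel)
         = (\<integral>\<^sup>+s. ennreal ((zeta \<omega> - c - s)\<^sup>2 * (exp (L s \<omega>) / mom 0 \<omega> 0)) \<partial>lborel)"
        by (subst nn_integral_real_affine[where c="-1" and t=0 and f="\<lambda>s. ennreal ((zeta \<omega> - c - s)\<^sup>2 * (exp (L s \<omega>) / mom 0 \<omega> 0))"])
           (use m in auto)
      also have "\<dots> = ennreal (\<integral>s. (zeta \<omega> - c - s)\<^sup>2 * (exp (L s \<omega>) / mom 0 \<omega> 0) \<partial>lborel)"
        using elim by (intro nn_integral_eq_integral) auto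
      also have "(\<integral>s. (zeta \<omega> - c - s)\<^sup>2 * (exp (L s \<omega>) / mom 0 \<omega> 0) \<partial>lborel) = V \<omega> 0 + (zeta \<omega> - c - zeta \<omega>)\<^sup>2"
        using elim by blast
      finally show ?case by simp
    qed
  qed
  finally show ?thesis .
qed

lemma V_0_integrable: "integrable M (\<lambda>\<omega>. V \<omega> 0)"
proof (rule Bochner_Integration.integrable_bound[OF bd_integrable])
  show "AE \<omega> in M. norm (V \<omega> 0) \<le> norm (bd \<omega>)"
    using AE_derivatives(3)
  proof eventually_elim
    case (elim \<omega>)
    then have "\<bar>V \<omega> 0\<bar> \<le> bd \<omega>" by auto
    then show ?case by simp
  qed
qed measurable

text \<open>The identity holds in \<open>[0, \<infinity>]\<close> and its right side is finite
  because \<open>V\<close> is bounded by \<open>bd\<close>; square integrability of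
  \<open>zeta\<close> is thus a result of it.\<close>

lemma zeta_second_moment:
  "integrable M (\<lambda>\<omega>. (zeta \<omega> - c)\<^sup>2)"
  "expectation (\<lambda>\<omega>. (zeta \<omega> - c)\<^sup>2) = expectation (\<lambda>\<omega>. V \<omega> 0) + c\<^sup>2"
proof -
  have p: "AE \<omega> in M. 0 \<le> V \<omega> 0 + c\<^sup>2" using AE_derivatives(4) by eventually_elim auto
  have n: "(\<integral>\<^sup>+\<omega>. ennreal ((zeta \<omega> - c)\<^sup>2) \<partial>M) = ennreal (expectation (\<lambda>\<omega>. V \<omega> 0 + c\<^sup>2))"
    unfolding zeta_second_moment_nn using V_0_integrable p by (intro nn_integral_eq_integral) auto
  show i: "integrable M (\<lambda>\<omega>. (zeta \<omega> - c)\<^sup>2)"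
    by (rule integrableI_nonneg) (auto simp: n)
  have "ennreal (expectation (\<lambda>\<omega>. (zeta \<omega> - c)\<^sup>2)) = ennreal (expectation (\<lambda>\<omega>. V \<omega> 0 + c\<^sup>2))"
    unfolding n[symmetric] by (rule nn_integral_eq_integral[symmetric, OF i]) auto
  moreover have "0 \<le> expectation (\<lambda>\<omega>. V \<omega> 0 + c\<^sup>2)" using p by (rule integral_nonneg_AE)
  moreover have "0 \<le> expectation (\<lambda>\<omega>. (zeta \<omega> - c)\<^sup>2)" by (intro integral_nonneg_AE) auto
  ultimately have "expectation (\<lambda>\<omega>. (zeta \<omega> - c)\<^sup>2) = expectation (\<lambda>\<omega>. V \<omega> 0 + c\<^sup>2)" by simp
  then show "expectation (\<lambda>\<omega>. (zeta \<omega> - c)\<^sup>2) = expectation (\<lambda>\<omega>. V \<omega> 0) + c\<^sup>2"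
    using V_0_integrable by (simp add: prob_space)
qed

text \<open>From \<open>c = 0\<close> to \<open>c = 1\<close> the second moment grows by exactly 1,
  whereas expanding the square gives a growth of \<open>1 - 2 * expectation zeta\<close>.\<close>

lemma zeta_mean: "expectation zeta = 0"
proof -
  have iz: "integrable M zeta" using tilted_mean_integrable[of 0] by (simp add: zeta_def[abs_def])
  have i2: "integrable M (\<lambda>\<omega>. (zeta \<omega>)\<^sup>2)" using zeta_second_moment(1)[of 0] by simp
  have "expectation (\<lambda>\<omega>. (zeta \<omega> - 1)\<^sup>2) = expectation (\<lambda>\<omega>. (zeta \<omega>)\<^sup>2 - 2 * zeta \<omega> + 1)"
    by (rule Bochner_Integration.integral_cong) (auto simp: power2_eq_square algebra_simps)
  also have "\<dots> = expectation (\<lambda>\<omega>. (zeta \<omega>)\<^sup>2) - 2 * expectation zeta + 1"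
    using iz i2 by (simp add: prob_space)
  finally show ?thesis using zeta_second_moment(2)[of 1] zeta_second_moment(2)[of 0] by simp
qed

end

theorem theorem3:
  fixes M :: "'a measure" and H :: real and W :: "real \<Rightarrow> 'a \<Rightarrow> real"
  assumes "1/2 \<le> H" and "H \<le> 1"
    and "is_two_sided_fBm M H W"
  shows "\<exists>g' g''.
      (\<forall>m\<in>{-1/8<..<1/8::real}.
          integrable M (\<lambda>\<omega>. ln (\<integral>u. fBm_Z H W u \<omega> * exp (m * u) \<partial>lborel))
        \<and> (fBm_g M H W has_real_derivative g' m) (at m)
        \<and> (g' has_real_derivative g'' m) (at m))
      \<and> continuous_on {-1/8<..<1/8} g''
      \<and> integrable M (\<lambda>\<omega>. (fBm_zeta H W \<omega>)\<^sup>2)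
      \<and> integral\<^sup>L M (\<lambda>\<omega>. (fBm_zeta H W \<omega> - integral\<^sup>L M (fBm_zeta H W))\<^sup>2) = g'' 0"
proof -
  interpret prob_space M using assms(3) by (simp add: is_two_sided_fBm_def)
  interpret fbm M H W by unfold_locales (use assms in auto)
  let ?g' = "\<lambda>m. expectation (\<lambda>\<omega>. mom 1 \<omega> m / mom 0 \<omega> m)" and ?g'' = "\<lambda>m. expectation (\<lambda>\<omega>. V \<omega> m)"
  have 1: "\<forall>m\<in>{-1/8<..<1/8}. integrable M (\<lambda>\<omega>. ln (\<integral>u. fBm_Z H W u \<omega> * exp (m * u) \<partial>lborel))
      \<and> (fBm_g M H W has_real_derivative ?g' m) (at m) \<and> (?g' has_real_derivative ?g'' m) (at m)"
    unfolding integral_fBm_Z fBm_g_eq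
    by (intro ballI conjI ln_mom_integrable
         has_real_derivative_integral[OF ln_mom_integrable _ AE_derivatives(1) bd_integrable]
         has_real_derivative_integral[OF tilted_mean_integrable _ AE_derivatives(2) bd_integrable]) measurable
  have 2: "continuous_on {-1/8<..<1/8} ?g''"
    by (rule continuous_on_integral_dominated[OF _ AE_derivatives(3) bd_integrable]) measurable
  have 3: "integrable M (\<lambda>\<omega>. (fBm_zeta H W \<omega>)\<^sup>2)"
    using zeta_second_moment(1)[of 0] by (simp add: fBm_zeta_eq)
  have 4: "integral\<^sup>L M (\<lambda>\<omega>. (fBm_zeta H W \<omega> - integral\<^sup>L M (fBm_zeta H W))\<^sup>2) = ?g'' 0"
    using zeta_second_moment(2)[of 0] by (simp add: fBm_zeta_eq zeta_mean)
  show ?thesis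
    by (rule exI[of _ ?g'], rule exI[of _ ?g''], rule conjI[OF 1 conjI[OF 2 conjI[OF 3 4]]])
qed

end
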